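(* Let $D=\{1,\dots,d\}$, let $V_1,\dots,V_d$ be real vector spaces, $\mathbf{V}_D={}_a\bigotimes_{j=1}^dV_j$, and let $T_D$ be a dimension partition tree over $D$ with $\mathrm{depth}(T_D)=\mathfrak{d}$. Given $\mathfrak{r}=(r_\alpha)_{\alpha\in T_D}\in\mathcal{AD}(\mathbf{V}_D,T_D)$, the following statements are equivalent. (a) $\mathbf{v}\in\mathcal{FT}_{\mathfrak{r}}(\mathbf{V}_D,T_D)$. (b) Given $\{u_{i_k}^{(k)}:1\le i_k\le r_k\}$ a fixed basis of $U_k^{\min}(\mathbf{v})$ for $k\in\mathcal{L}(T_D)$, $$\mathbf{v}=\sum_{\substack{1\le i_\alpha\le r_\alpha\\ \alpha\in S(D)}}C^{(D)}_{(i_\alpha)_{\alpha\in S(D)}}\bigotimes_{\alpha\in S(D)}\mathbf{u}_{i_\alpha}^{(\alpha)}$$ for a unique $C^{(D)}\in\mathfrak{M}_{r}\big(\mathbb{R}^{\times_{\beta\in S(D)}r_\beta}\big)$, where $r=(r_\beta)_{\beta\in S(D)}$, and where for each $\mu\in T_D\setminus\{D\}$ such that $S(\mu)\ne\emptyset$ there exists a unique $C^{(\mu)}\in\mathbb{R}^{r_\mu\times(\times_{\beta\in S(\mu)}r_\beta)}$ such that $\mathrm{rank}\,\mathcal{M}_\mu(C^{(\mu)})=\dim U_\mu^{\min}(\mathbf{v})=r_\mu$ and the set $\{\mathbf{u}_{i_\mu}^{(\mu)}:1\le i_\mu\le r_\mu\}$, with $$\mathbf{u}_{i_\mu}^{(\mu)}=\sum_{\substack{1\le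 i_\beta\le r_\beta\\ \beta\in S(\mu)}}C^{(\mu)}_{i_\mu,(i_\beta)_{\beta\in S(\mu)}}\bigotimes_{\beta\in S(\mu)}\mathbf{u}_{i_\beta}^{(\beta)}\qquad\text{for }1\le i_\mu\le r_\mu,$$ is a basis of $U_\mu^{\min}(\mathbf{v})$. (For a leaf $\beta=\{k\}$, $\mathbf{u}^{(\beta)}_{i}$ means $u^{(k)}_{i}$.)
   Context: All vector spaces are over $\mathbb{R}$; ${}_a\bigotimes$ is the algebraic tensor product. For non-empty $\alpha\subset D$, $\mathbf{V}_\alpha:={}_a\bigotimes_{j\in\alpha}V_j$ (so $\mathbf{V}_{\{j\}}=V_j$); $\mathbf{V}_D$ is identified with $\mathbf{V}_\alpha\otimes_a\mathbf{V}_{\alpha^c}$, $\alpha^c=D\setminus\alpha$, for $\emptyset\ne\alpha\subsetneq D$, and $\mathbf V_\alpha$ with ${}_a\bigotimes_{\beta\in\mathcal P}\mathbf V_\beta$ for a partition $\mathcal P$ of $\alpha$. Minimal subspace: for $\mathbf{v}\in\mathbf{V}_D$ and $\emptyset\neq\alpha\subsetneq D$, $U_\alpha^{\min}(\mathbf{v})\subset\mathbf{V}_\alpha$ is the unique subspace such that $\mathbf{v}\in U_\alpha^{\min}(\mathbf{v})\otimes_a\mathbf{V}_{\alpha^c}$ and such that $\mathbf{v}\in\mathbf{U}_\alpha\otimes_a\mathbf{V}_{\alpha^c}$ for a subspace $\mathbf U_\alpha\subset \mathbf V_\alpha$ implies $U_\alpha^{\min}(\mathbf{v})\subset\mathbf{U}_\alpha$.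 It exists and is finite-dimensional. By convention $U_D^{\min}(\mathbf{v})=\mathrm{span}\{\mathbf{v}\}$, and $U^{\min}_k:=U^{\min}_{\{k\}}$. Dimension partition tree $T_D$ of $D$: a rooted tree whose vertices are non-empty subsets of $D$, with root $D$, such that every vertex $\alpha$ with $\#\alpha\ge2$ has at least two sons and its set of sons $S(\alpha)$ is a non-trivial partition of $\alpha$, and every vertex $\alpha$ with $\#\alpha=1$ has no son ($S(\alpha)=\emptyset$) and is called a leaf. The set of leaves is $\mathcal{L}(T_D)=\{\{j\}:j\in D\}$; a leaf $\{k\}$ is also written $k$. The level of a vertex is given by $\mathrm{level}(D)=0$ and $\mathrm{level}(\beta)=\mathrm{level}(\alpha)+1$ for $\beta\in S(\alpha)$, and $\mathrm{depth}(T_D)=\max_{\alpha\in T_D}\mathrm{level}(\alpha)$. Admissible ranks: $\mathcal{AD}(\mathbf{V}_D,T_D):=\{(\dim U_\alpha^{\min}(\mathbf{w}))_{\alpha\in T_D}:\mathbf{w}\in\mathbf{V}_D\}$. The set of tensors of fixed tree-based rank $\mathfrak{r}$ is $\mathcal{FT}_{\mathfrak{r}}(\mathbf{V}_D,T_D):=\{\mathbf{w}\in\mathbf{V}_D:\dim U_\alpha^{\min}(\mathbf{w})=r_\alpha\text{ for all }\alpha\in T_D\}$. Matricisation: for a finite tensor $C$ with a family of indices, one of which is $i_\beta\in\{1,\dots,r_\beta\}$, $\mathcal{M}_\beta(C)$ is the matrix whose row index is $i_\beta$ and whose column index is the tuple of all the other indices. In particular $\mathcal{M}_\mu(C^{(\mu)})$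 is an $r_\mu\times\prod_{\beta\in S(\mu)}r_\beta$ matrix. $\mathfrak{M}_r(\mathbb{R}^{\times_{\beta\in S(D)}r_\beta})$ is the set of $C\in\mathbb{R}^{\times_{\beta\in S(D)}r_\beta}$ with $\mathrm{rank}\,\mathcal{M}_\beta(C)=r_\beta$ for every $\beta\in S(D)$.
   Formalization: In (b), C^(D) and the C^(μ) are proved unique only relative to some choice of the bases u^(μ) at inner vertices; absolute uniqueness fails, as 2C^(μ) also gives a basis. It is also assumed that d ≥ 2, since for d = 1 the set S(D) is empty. *)

theory Defs
  imports "HOL-Analysis.Analysis" "HOL-Analysis.Finite_Function_Topology"
begin

section \<open>The algebraic tensor product\<close>

text \<open>
  The type of tensors is the free vector space over all families of vectors indexed by subsets of
  the naturals (partial functions from \<^typ>\<open>nat\<close>), modulo the relations of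
  multilinearity. The relations preserve the domain of a family, so the type is the direct sum, over
  all index sets \<open>\<alpha>\<close>, of the usual quotient construction of the tensor product of copies
  of \<^typ>\<open>'a\<close> indexed by \<open>\<alpha>\<close>. Gluing of families with disjoint domains yields one
  commutative product that realises all the identifications of
  \<open>V\<^sub>\<alpha> \<otimes> V\<^sub>\<beta>\<close> with \<open>V\<^sub>\<alpha>\<^sub>\<union>\<^sub>\<beta>\<close> for disjoint \<open>\<alpha>\<close> and \<open>\<beta>\<close>.
\<close>

definition tensor_relations :: "((nat \<rightharpoonup> 'a::real_vector) \<Rightarrow>\<^sub>0 real) set" where
  "tensor_relations =
     {Poly_Mapping.single (f(j \<mapsto> x + y)) 1 - Poly_Mapping.single (f(j \<mapsto> x)) 1
        - Poly_Mapping.single (f(j \<mapsto> y)) 1 | f j x y. True} \<union>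
     {Poly_Mapping.single (f(j \<mapsto> c *\<^sub>R x)) 1 - c *\<^sub>R Poly_Mapping.single (f(j \<mapsto> x)) 1 | f j c x. True}"

definition tensor_eq ::
    "((nat \<rightharpoonup> 'a::real_vector) \<Rightarrow>\<^sub>0 real) \<Rightarrow> ((nat \<rightharpoonup> 'a) \<Rightarrow>\<^sub>0 real) \<Rightarrow> bool" where
  "tensor_eq p q \<longleftrightarrow> p - q \<in> span tensor_relations"

lemma tensor_eq_add: "tensor_eq p q \<Longrightarrow> tensor_eq p' q' \<Longrightarrow> tensor_eq (p + p') (q + q')"
  unfolding tensor_eq_def by (drule (1) span_add) (simp add: algebra_simps)

lemma tensor_eq_minus: "tensor_eq p q \<Longrightarrow> tensor_eq (- p) (- q)"
  unfolding tensor_eq_def by (drule span_neg) (simp add: algebra_simps)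

lemma tensor_eq_diff: "tensor_eq p q \<Longrightarrow> tensor_eq p' q' \<Longrightarrow> tensor_eq (p - p') (q - q')"
  unfolding tensor_eq_def by (drule (1) span_diff) (simp add: algebra_simps)

lemma tensor_eq_scale: "tensor_eq p q \<Longrightarrow> tensor_eq (c *\<^sub>R p) (c *\<^sub>R q)"
  unfolding tensor_eq_def by (drule span_scale[where c=c]) (simp add: scaleR_diff_right)

lemma tensor_eq_refl: "tensor_eq p p"
  by (simp add: tensor_eq_def span_zero)

lemma tensor_eq_sym: "tensor_eq p q \<Longrightarrow> tensor_eq q p"
  unfolding tensor_eq_def using span_neg[of "p - q"] by simp

lemma tensor_eq_trans: "tensor_eq p q \<Longrightarrow> tensor_eq q s \<Longrightarrow> tensor_eq p s"
  unfolding tensor_eq_def using span_add[of "p - q" _ "q - s"] by simp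

lemma equivp_tensor_eq: "equivp tensor_eq"
  by (intro equivpI reflpI sympI transpI) (fact tensor_eq_refl tensor_eq_sym tensor_eq_trans)+

quotient_type (overloaded) 'a tensor = "(nat \<rightharpoonup> 'a::real_vector) \<Rightarrow>\<^sub>0 real" / tensor_eq
  by (rule equivp_tensor_eq)

definition lin_ext :: "('k \<Rightarrow> 'b::real_vector) \<Rightarrow> ('k \<Rightarrow>\<^sub>0 real) \<Rightarrow> 'b" where
  "lin_ext h p = (\<Sum>k\<in>Poly_Mapping.keys p. Poly_Mapping.lookup p k *\<^sub>R h k)"

definition free_mult :: "((nat \<rightharpoonup> 'a) \<Rightarrow>\<^sub>0 real) \<Rightarrow> ((nat \<rightharpoonup> 'a) \<Rightarrow>\<^sub>0 real) \<Rightarrow> ((nat \<rightharpoonup> 'a) \<Rightarrow>\<^sub>0 real)" where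
  "free_mult p q = lin_ext (\<lambda>f. lin_ext (\<lambda>g.
     if dom f \<inter> dom g = {} then Poly_Mapping.single (f ++ g) 1 else 0) q) p"

lemma lookup_scaleR_pm [simp]: "Poly_Mapping.lookup (c *\<^sub>R p) k = c *\<^sub>R Poly_Mapping.lookup p k"
proof -
  have "finite {i. c *\<^sub>R Poly_Mapping.lookup p i \<noteq> 0}"
    by (rule finite_subset[OF _ finite_lookup[of p]]) auto
  then show ?thesis by (simp add: scaleR_poly_mapping_def Abs_poly_mapping_inverse)
qed

lemma lin_ext_superset:
  assumes "finite K" "Poly_Mapping.keys p \<subseteq> K"
  shows "lin_ext h p = (\<Sum>k\<in>K. Poly_Mapping.lookup p k *\<^sub>R h k)"
  unfolding lin_ext_def using assms by (intro sum.mono_neutral_left) (auto simp: in_keys_iff)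

lemma linear_lin_ext: "linear (lin_ext h)"
proof (rule linearI)
  fix p q :: "'a \<Rightarrow>\<^sub>0 real"
  let ?K = "Poly_Mapping.keys p \<union> Poly_Mapping.keys q"
  have "Poly_Mapping.keys (p + q) \<subseteq> ?K" by (rule keys_add)
  then show "lin_ext h (p + q) = lin_ext h p + lin_ext h q"
    by (simp add: lin_ext_superset[of ?K] lookup_add scaleR_left_distrib sum.distrib)
next
  fix c and p :: "'a \<Rightarrow>\<^sub>0 real"
  have "Poly_Mapping.keys (c *\<^sub>R p) \<subseteq> Poly_Mapping.keys p" by (auto simp: in_keys_iff)
  then show "lin_ext h (c *\<^sub>R p) = c *\<^sub>R lin_ext h p"
    by (simp add: lin_ext_superset[of "Poly_Mapping.keys p"] scaleR_sum_right)
qed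

lemma lin_ext_single [simp]: "lin_ext h (Poly_Mapping.single k c) = c *\<^sub>R h k"
  by (simp add: lin_ext_superset[of "{k}"])

lemma linear_eq_on_single:
  fixes F G :: "('k \<Rightarrow>\<^sub>0 real) \<Rightarrow> 'b::real_vector"
  assumes "linear F" "linear G"
    and "\<And>k. F (Poly_Mapping.single k 1) = G (Poly_Mapping.single k 1)"
  shows "F p = G p"
proof -
  have p: "lin_ext (\<lambda>k. Poly_Mapping.single k 1) p = p"
  proof (rule poly_mapping_eqI)
    fix k
    have "Poly_Mapping.lookup (lin_ext (\<lambda>k. Poly_Mapping.single k 1) p) k =
        (\<Sum>j\<in>Poly_Mapping.keys p. if j = k then Poly_Mapping.lookup p j else 0)"
      unfolding lin_ext_def lookup_sum
      by (rule sum.cong) (simp_all add: lookup_single when_def)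
    also have "\<dots> = Poly_Mapping.lookup p k"
      by (simp add: in_keys_iff)
    finally show "Poly_Mapping.lookup (lin_ext (\<lambda>k. Poly_Mapping.single k 1) p) k =
        Poly_Mapping.lookup p k" .
  qed
  have "F (lin_ext (\<lambda>k. Poly_Mapping.single k 1) p) = G (lin_ext (\<lambda>k. Poly_Mapping.single k 1) p)"
    unfolding lin_ext_def linear_sum[OF assms(1)] linear_sum[OF assms(2)]
      linear_scale[OF assms(1)] linear_scale[OF assms(2)] assms(3) ..
  then show ?thesis
    unfolding p .
qed

lemma linear_free_mult_left: "linear (\<lambda>p. free_mult p q)"
  unfolding free_mult_def by (rule linear_lin_ext)

lemma linear_free_mult_right: "linear (free_mult p)"
proof -
  define H where "H f = lin_ext (\<lambda>g. if dom f \<inter> dom g = {} then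
    Poly_Mapping.single (f ++ g) (1::real) else 0)" for f :: "nat \<rightharpoonup> 'a"
  have lin: "linear (H f)" for f
    unfolding H_def by (rule linear_lin_ext)
  have eq: "free_mult p q = (\<Sum>f\<in>Poly_Mapping.keys p. Poly_Mapping.lookup p f *\<^sub>R H f q)" for q
    unfolding free_mult_def lin_ext_def[where p=p] H_def ..
  show ?thesis
  proof (rule linearI)
    fix q q' c
    show "free_mult p (q + q') = free_mult p q + free_mult p q'"
      unfolding eq linear_add[OF lin] scaleR_add_right sum.distrib ..
    show "free_mult p (c *\<^sub>R q) = c *\<^sub>R free_mult p q"
      unfolding eq linear_scale[OF lin] scaleR_sum_right
      by (rule sum.cong) (simp_all add: mult.commute)
  qed
qed

lemmas free_mult_add_left = linear_add[OF linear_free_mult_left]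
  and free_mult_diff_left = linear_diff[OF linear_free_mult_left]
  and free_mult_scale_left = linear_scale[OF linear_free_mult_left]
  and free_mult_add_right = linear_add[OF linear_free_mult_right]
  and free_mult_diff_right = linear_diff[OF linear_free_mult_right]
  and free_mult_scale_right = linear_scale[OF linear_free_mult_right]

lemma free_mult_single [simp]:
  "free_mult (Poly_Mapping.single f 1) (Poly_Mapping.single g 1) =
     (if dom f \<inter> dom g = {} then Poly_Mapping.single (f ++ g) 1 else 0)"
  by (simp add: free_mult_def)

lemma free_mult_commute: "free_mult p q = free_mult q p"
proof (rule linear_eq_on_single[OF linear_free_mult_left linear_free_mult_right])
  fix f
  show "free_mult (Poly_Mapping.single f 1) q = free_mult q (Poly_Mapping.single f 1)"
    by (rule linear_eq_on_single[OF linear_free_mult_right linear_free_mult_left])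
       (auto simp: map_add_comm Int_commute)
qed

lemma linear_free_mult_left': "linear F \<Longrightarrow> linear (\<lambda>x. free_mult (F x) q)"
  using linear_compose[OF _ linear_free_mult_left] by (simp only: o_def)

lemma linear_free_mult_right': "linear F \<Longrightarrow> linear (\<lambda>x. free_mult p (F x))"
  using linear_compose[OF _ linear_free_mult_right] by (simp only: o_def)

lemma free_mult_assoc: "free_mult (free_mult p q) s = free_mult p (free_mult q s)"
proof -
  have 0: "free_mult 0 t = 0" "free_mult t 0 = 0" for t :: "(nat \<rightharpoonup> 'a) \<Rightarrow>\<^sub>0 real"
    by (simp_all add: free_mult_def lin_ext_def)
  note lin = linear_free_mult_left' linear_free_mult_right' linear_id[unfolded id_def]
  let ?S = "\<lambda>f :: nat \<rightharpoonup> 'a. Poly_Mapping.single f (1::real)"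
  have 1: "free_mult (free_mult (?S f) (?S g)) (?S h) = free_mult (?S f) (free_mult (?S g) (?S h))" for f g h
    by (cases "dom f \<inter> dom g = {}"; cases "dom g \<inter> dom h = {}"; cases "dom f \<inter> dom h = {}")
       (simp_all add: 0 Int_Un_distrib Int_Un_distrib2)
  have 2: "free_mult (free_mult (?S f) (?S g)) s = free_mult (?S f) (free_mult (?S g) s)" for f g
    by (rule linear_eq_on_single[where F="\<lambda>s. free_mult (free_mult (?S f) (?S g)) s"
          and G="\<lambda>s. free_mult (?S f) (free_mult (?S g) s)"]) (intro lin 1)+
  have 3: "free_mult (free_mult (?S f) q) s = free_mult (?S f) (free_mult q s)" for f
    by (rule linear_eq_on_single[where F="\<lambda>q. free_mult (free_mult (?S f) q) s"
          and G="\<lambda>q. free_mult (?S f) (free_mult q s)"]) (intro lin 2)+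
  show ?thesis
    by (rule linear_eq_on_single[where F="\<lambda>p. free_mult (free_mult p q) s"
          and G="\<lambda>p. free_mult p (free_mult q s)"]) (intro lin 3)+
qed

lemma free_mult_relation:
  assumes "t \<in> tensor_relations"
  shows "free_mult t (Poly_Mapping.single g 1) \<in> span tensor_relations"
proof -
  have upd: "(f(j \<mapsto> z)) ++ g = (f ++ g)(j \<mapsto> z)" if "j \<notin> dom g" for f :: "nat \<rightharpoonup> 'a" and j z
    using that by (simp add: map_add_upd_left)
  from assms consider
    f j x y where "t = Poly_Mapping.single (f(j \<mapsto> x + y)) 1 - Poly_Mapping.single (f(j \<mapsto> x)) 1
        - Poly_Mapping.single (f(j \<mapsto> y)) 1"
    | f j c x where "t = Poly_Mapping.single (f(j \<mapsto> c *\<^sub>R x)) 1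
        - c *\<^sub>R Poly_Mapping.single (f(j \<mapsto> x)) 1"
    unfolding tensor_relations_def by blast
  then show ?thesis
  proof cases
    case 1
    show ?thesis
    proof (cases "insert j (dom f) \<inter> dom g = {}")
      case True
      then have j: "j \<notin> dom g" and fg: "insert j (dom f) \<inter> dom g = {}" by auto
      have "free_mult t (Poly_Mapping.single g 1) =
          Poly_Mapping.single ((f ++ g)(j \<mapsto> x + y)) 1 - Poly_Mapping.single ((f ++ g)(j \<mapsto> x)) 1
            - Poly_Mapping.single ((f ++ g)(j \<mapsto> y)) 1"
        unfolding 1 free_mult_diff_left free_mult_single using fg by (simp add: upd[OF j])
      then have "free_mult t (Poly_Mapping.single g 1) \<in> tensor_relations"
        unfolding tensor_relations_def by blast
      then show ?thesis by (rule span_base)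
    next
      case False
      then show ?thesis
        unfolding 1 free_mult_diff_left free_mult_single by (auto simp: span_zero)
    qed
  next
    case 2
    show ?thesis
    proof (cases "insert j (dom f) \<inter> dom g = {}")
      case True
      then have j: "j \<notin> dom g" and fg: "insert j (dom f) \<inter> dom g = {}" by auto
      have "free_mult t (Poly_Mapping.single g 1) =
          Poly_Mapping.single ((f ++ g)(j \<mapsto> c *\<^sub>R x)) 1
            - c *\<^sub>R Poly_Mapping.single ((f ++ g)(j \<mapsto> x)) 1"
        unfolding 2 free_mult_diff_left free_mult_scale_left free_mult_single
        using fg by (simp add: upd[OF j])
      then have "free_mult t (Poly_Mapping.single g 1) \<in> tensor_relations"
        unfolding tensor_relations_def by blast
      then show ?thesis by (rule span_base)
    next
      case False
      then show ?thesis
        unfolding 2 free_mult_diff_left free_mult_scale_left free_mult_single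
        by (auto simp: span_zero)
    qed
  qed
qed

lemma free_mult_ideal:
  assumes "t \<in> span tensor_relations"
  shows "free_mult t q \<in> span tensor_relations"
proof -
  have 1: "free_mult t (Poly_Mapping.single g 1) \<in> span tensor_relations" for g
    using assms
  proof (induction rule: span_induct_alt)
    case base
    then show ?case by (simp add: linear_0[OF linear_free_mult_left] span_zero)
  next
    case (step c x y)
    then show ?case
      by (simp add: free_mult_add_left free_mult_scale_left span_add span_scale free_mult_relation)
  qed
  have q: "free_mult t q = lin_ext (\<lambda>g. free_mult t (Poly_Mapping.single g 1)) q"
    by (rule linear_eq_on_single[OF linear_free_mult_right linear_lin_ext]) simp
  show ?thesis
    unfolding q lin_ext_def by (intro span_sum span_scale 1)
qed

lemma tensor_eq_mult:
  assumes "tensor_eq p q" "tensor_eq p' q'"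
  shows "tensor_eq (free_mult p p') (free_mult q q')"
proof -
  have "free_mult p p' - free_mult q q' = free_mult (p - q) p' + free_mult (p' - q') q"
    by (simp add: free_mult_diff_left free_mult_commute[of q])
  then show ?thesis
    using assms unfolding tensor_eq_def by (simp add: span_add free_mult_ideal)
qed

lemma not_tensor_eq_0_1: "\<not> tensor_eq 0 (Poly_Mapping.single Map.empty 1)"
proof
  define \<phi> :: "((nat \<rightharpoonup> 'a) \<Rightarrow>\<^sub>0 real) \<Rightarrow> real"
    where "\<phi> = lin_ext (\<lambda>f. if f = Map.empty then 1 else 0)"
  have lin: "linear \<phi>" unfolding \<phi>_def by (rule linear_lin_ext)
  have "\<phi> t = 0" if "t \<in> tensor_relations" for t
    using that unfolding tensor_relations_def
    by (auto simp: linear_diff[OF lin] linear_scale[OF lin]) (auto simp: \<phi>_def)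
  then have z: "\<phi> t = 0" if "t \<in> span tensor_relations" for t
    using linear_eq_0_on_span[OF lin] that by blast
  assume "tensor_eq (0 :: (nat \<rightharpoonup> 'a) \<Rightarrow>\<^sub>0 real) (Poly_Mapping.single Map.empty 1)"
  then have "\<phi> (0 - Poly_Mapping.single Map.empty 1) = 0"
    unfolding tensor_eq_def by (rule z)
  then show False by (simp add: linear_neg[OF lin]) (simp add: \<phi>_def)
qed

text \<open>
  The product is bilinear with \<open>[f] * [g] = [f ++ g]\<close> for families with disjoint domains. The
  convention \<open>[f] * [g] = 0\<close> for overlapping domains only serves to make it total.
\<close>

instantiation tensor :: (real_vector) "{real_algebra_1, comm_ring_1}"
begin

lift_definition zero_tensor :: "'a tensor" is 0 .
lift_definition one_tensor :: "'a tensor" is "Poly_Mapping.single Map.empty 1" .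
lift_definition plus_tensor :: "'a tensor \<Rightarrow> 'a tensor \<Rightarrow> 'a tensor" is "(+)"
  by (rule tensor_eq_add)
lift_definition uminus_tensor :: "'a tensor \<Rightarrow> 'a tensor" is uminus
  by (rule tensor_eq_minus)
lift_definition minus_tensor :: "'a tensor \<Rightarrow> 'a tensor \<Rightarrow> 'a tensor" is "(-)"
  by (rule tensor_eq_diff)
lift_definition scaleR_tensor :: "real \<Rightarrow> 'a tensor \<Rightarrow> 'a tensor" is scaleR
  by (rule tensor_eq_scale)
lift_definition times_tensor :: "'a tensor \<Rightarrow> 'a tensor \<Rightarrow> 'a tensor" is free_mult
  by (rule tensor_eq_mult)

instance
proof
  have eq: "tensor_eq p q" if "p = q" for p q :: "(nat \<rightharpoonup> 'a) \<Rightarrow>\<^sub>0 real"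
    using that by (simp add: tensor_eq_refl)
  have one: "free_mult (Poly_Mapping.single Map.empty 1) p = p" for p :: "(nat \<rightharpoonup> 'a) \<Rightarrow>\<^sub>0 real"
    by (rule linear_eq_on_single[OF linear_free_mult_right linear_id[unfolded id_def]]) simp
  fix a b c :: "'a tensor" and x y :: real
  show "a + b + c = a + (b + c)" by transfer (rule eq, rule add.assoc)
  show "a + b = b + a" by transfer (rule eq, rule add.commute)
  show "0 + a = a" by transfer (rule eq, simp)
  show "- a + a = 0" by transfer (rule eq, simp)
  show "a - b = a + - b" by transfer (rule eq, simp)
  show "x *\<^sub>R (a + b) = x *\<^sub>R a + x *\<^sub>R b" by transfer (rule eq, rule scaleR_add_right)
  show "(x + y) *\<^sub>R a = x *\<^sub>R a + y *\<^sub>R a" by transfer (rule eq, rule scaleR_add_left)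
  show "x *\<^sub>R y *\<^sub>R a = (x * y) *\<^sub>R a" by transfer (rule eq, simp)
  show "1 *\<^sub>R a = a" by transfer (rule eq, simp)
  show "x *\<^sub>R a * b = x *\<^sub>R (a * b)" by transfer (rule eq, rule free_mult_scale_left)
  show "a * x *\<^sub>R b = x *\<^sub>R (a * b)" by transfer (rule eq, rule free_mult_scale_right)
  show "a * b * c = a * (b * c)" by transfer (rule eq, rule free_mult_assoc)
  show "a * b = b * a" by transfer (rule eq, rule free_mult_commute)
  show "1 * a = a" by transfer (rule eq, rule one)
  show "a * 1 = a" by transfer (rule eq, rule trans[OF free_mult_commute one])
  show "(a + b) * c = a * c + b * c" by transfer (rule eq, rule free_mult_add_left)
  show "a * (b + c) = a * b + a * c" by transfer (rule eq, rule free_mult_add_right)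
  show "(0::'a tensor) \<noteq> 1" by transfer (rule not_tensor_eq_0_1)
qed

end

text \<open>The elementary tensor of the family \<open>(v\<^sub>j)\<close> with \<open>j \<in> \<alpha>\<close>.\<close>

lift_definition elem_tensor :: "nat set \<Rightarrow> (nat \<Rightarrow> 'a::real_vector) \<Rightarrow> 'a tensor"
  is "\<lambda>\<alpha> v. Poly_Mapping.single ((\<lambda>j. Some (v j)) |` \<alpha>) 1" .

lemma elem_tensor_mult:
  assumes "\<alpha> \<inter> \<beta> = {}"
  shows "elem_tensor \<alpha> v * elem_tensor \<beta> w = elem_tensor (\<alpha> \<union> \<beta>) (\<lambda>j. if j \<in> \<alpha> then v j else w j)"
  using assms
proof transfer
  fix \<alpha> \<beta> :: "nat set" and v w :: "nat \<Rightarrow> 'a"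
  assume *: "\<alpha> \<inter> \<beta> = {}"
  let ?f = "(\<lambda>j. Some (v j)) |` \<alpha>" and ?g = "(\<lambda>j. Some (w j)) |` \<beta>"
  have "dom ?f \<inter> dom ?g = {}" using * by (auto simp: restrict_map_def split: if_splits)
  moreover have "?f ++ ?g = (\<lambda>j. Some (if j \<in> \<alpha> then v j else w j)) |` (\<alpha> \<union> \<beta>)"
    using * by (auto simp: map_add_def restrict_map_def fun_eq_iff)
  ultimately show "tensor_eq (free_mult (Poly_Mapping.single ?f 1) (Poly_Mapping.single ?g 1))
      (Poly_Mapping.single ((\<lambda>j. Some (if j \<in> \<alpha> then v j else w j)) |` (\<alpha> \<union> \<beta>)) 1)"
    by (simp add: tensor_eq_refl)
qed

text \<open>
  For subspaces \<open>V\<^sub>j\<close> of one ambient space (any family of vector spaces is of this form, inside its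
  direct sum), the tensor product is the span of the elementary tensors with \<open>v\<^sub>j \<in> V\<^sub>j\<close>. Over
  a field this is the intrinsic tensor product, since tensoring preserves injectivity.
\<close>

definition tensor_space :: "(nat \<Rightarrow> 'a::real_vector set) \<Rightarrow> nat set \<Rightarrow> 'a tensor set" where
  "tensor_space V \<alpha> = span {elem_tensor \<alpha> v | v. \<forall>j\<in>\<alpha>. v j \<in> V j}"

definition subspace_tensor :: "'a::real_vector tensor set \<Rightarrow> 'a tensor set \<Rightarrow> 'a tensor set"
    (infixr \<open>\<otimes>\<^sub>a\<close> 70) where
  "X \<otimes>\<^sub>a Y = span {x * y | x y. x \<in> X \<and> y \<in> Y}"

definition Umin :: "(nat \<Rightarrow> 'a::real_vector set) \<Rightarrow> nat set \<Rightarrow> nat set \<Rightarrow> 'a tensor \<Rightarrow> 'a tensor set" where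
  "Umin V D \<alpha> v =
     (if \<alpha> = D then span {v}
      else (THE U. subspace U \<and> U \<subseteq> tensor_space V \<alpha> \<and> v \<in> U \<otimes>\<^sub>a tensor_space V (D - \<alpha>) \<and>
             (\<forall>W. subspace W \<and> W \<subseteq> tensor_space V \<alpha> \<and> v \<in> W \<otimes>\<^sub>a tensor_space V (D - \<alpha>)
                \<longrightarrow> U \<subseteq> W)))"

section \<open>Dimension partition trees\<close>

text \<open>A tree is given by its vertex set \<open>T\<close> and the map \<open>S\<close> sending a vertex to the set of its sons.\<close>

definition tree_edges :: "nat set set \<Rightarrow> (nat set \<Rightarrow> nat set set) \<Rightarrow> (nat set \<times> nat set) set" where
  "tree_edges T S = {(\<alpha>, \<beta>). \<alpha> \<in> T \<and> \<beta> \<in> S \<alpha>}"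

definition rooted_tree :: "nat set \<Rightarrow> nat set set \<Rightarrow> (nat set \<Rightarrow> nat set set) \<Rightarrow> bool" where
  "rooted_tree D T S \<longleftrightarrow>
     D \<in> T \<and> (\<forall>\<alpha>\<in>T. S \<alpha> \<subseteq> T) \<and>
     (\<forall>\<alpha>\<in>T. D \<notin> S \<alpha>) \<and> (\<forall>\<beta>\<in>T - {D}. \<exists>!\<alpha>. \<alpha> \<in> T \<and> \<beta> \<in> S \<alpha>) \<and>
     (\<forall>\<alpha>\<in>T. (D, \<alpha>) \<in> (tree_edges T S)\<^sup>*)"

definition dim_partition_tree :: "nat set \<Rightarrow> nat set set \<Rightarrow> (nat set \<Rightarrow> nat set set) \<Rightarrow> bool" where
  "dim_partition_tree D T S \<longleftrightarrow>
     rooted_tree D T S \<and>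
     (\<forall>\<alpha>\<in>T. \<alpha> \<noteq> {} \<and> \<alpha> \<subseteq> D) \<and>
     (\<forall>\<alpha>\<in>T. 2 \<le> card \<alpha> \<longrightarrow> 2 \<le> card (S \<alpha>) \<and> partition_on \<alpha> (S \<alpha>)) \<and>
     (\<forall>\<alpha>\<in>T. card \<alpha> = 1 \<longrightarrow> S \<alpha> = {})"

definition leaves :: "nat set set \<Rightarrow> (nat set \<Rightarrow> nat set set) \<Rightarrow> nat set set" where
  "leaves T S = {\<alpha> \<in> T. S \<alpha> = {}}"

definition level :: "nat set \<Rightarrow> nat set set \<Rightarrow> (nat set \<Rightarrow> nat set set) \<Rightarrow> nat set \<Rightarrow> nat" where
  "level D T S \<alpha> = (THE n. (D, \<alpha>) \<in> tree_edges T S ^^ n)"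

definition depth :: "nat set \<Rightarrow> nat set set \<Rightarrow> (nat set \<Rightarrow> nat set set) \<Rightarrow> nat" where
  "depth D T S = Max (level D T S ` T)"

section \<open>Tensors of fixed tree-based rank\<close>

definition admissible_ranks ::
    "(nat \<Rightarrow> 'a::real_vector set) \<Rightarrow> nat set \<Rightarrow> nat set set \<Rightarrow> (nat set \<Rightarrow> nat) set" where
  "admissible_ranks V D T = {\<lambda>\<alpha>\<in>T. dim (Umin V D \<alpha> w) | w. w \<in> tensor_space V D}"

definition fixed_rank_tensors ::
    "(nat set \<Rightarrow> nat) \<Rightarrow> (nat \<Rightarrow> 'a::real_vector set) \<Rightarrow> nat set \<Rightarrow> nat set set \<Rightarrow> 'a tensor set" where
  "fixed_rank_tensors r V D T = {w \<in> tensor_space V D. \<forall>\<alpha>\<in>T. dim (Umin V D \<alpha> w) = r \<alpha>}"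

section \<open>Coefficient tensors and matricisation\<close>

text \<open>
  Multi-indices over a set \<open>A\<close> of vertices, and real arrays over them, are extensional functions,
  so that arrays of the given format are equal iff their entries are.
\<close>

definition multi_indices :: "nat set set \<Rightarrow> (nat set \<Rightarrow> nat) \<Rightarrow> (nat set \<Rightarrow> nat) set" where
  "multi_indices A r = (\<Pi>\<^sub>E \<beta>\<in>A. {1..r \<beta>})"

definition arrays :: "nat set set \<Rightarrow> (nat set \<Rightarrow> nat) \<Rightarrow> ((nat set \<Rightarrow> nat) \<Rightarrow> real) set" where
  "arrays A r = multi_indices A r \<rightarrow>\<^sub>E UNIV"

text \<open>The rank of a matrix is the dimension of its row space, as for the library's \<^const>\<open>rank\<close>.\<close>

definition matrix_row :: "'c set \<Rightarrow> ('c \<Rightarrow> real) \<Rightarrow> 'c \<Rightarrow>\<^sub>0 real" where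
  "matrix_row J a = (\<Sum>j\<in>J. Poly_Mapping.single j (a j))"

definition matrix_rank :: "'b set \<Rightarrow> 'c set \<Rightarrow> ('b \<Rightarrow> 'c \<Rightarrow> real) \<Rightarrow> nat" where
  "matrix_rank I J M = dim ((\<lambda>i. matrix_row J (M i)) ` I)"

definition matricise :: "nat set \<Rightarrow> ((nat set \<Rightarrow> nat) \<Rightarrow> real) \<Rightarrow> nat \<Rightarrow> (nat set \<Rightarrow> nat) \<Rightarrow> real" where
  "matricise \<beta> C = (\<lambda>i k. C (k(\<beta> := i)))"

definition matricisation_rank ::
    "nat set \<Rightarrow> nat set set \<Rightarrow> (nat set \<Rightarrow> nat) \<Rightarrow> ((nat set \<Rightarrow> nat) \<Rightarrow> real) \<Rightarrow> nat" where
  "matricisation_rank \<beta> A r C =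
     matrix_rank {1..r \<beta>} (multi_indices (A - {\<beta>}) r) (matricise \<beta> C)"

definition full_rank_arrays :: "nat set set \<Rightarrow> (nat set \<Rightarrow> nat) \<Rightarrow> ((nat set \<Rightarrow> nat) \<Rightarrow> real) set" where
  "full_rank_arrays A r = {C \<in> arrays A r. \<forall>\<beta>\<in>A. matricisation_rank \<beta> A r C = r \<beta>}"

section \<open>Tree-based representation\<close>

definition is_basis :: "nat \<Rightarrow> (nat \<Rightarrow> 'b::real_vector) \<Rightarrow> 'b set \<Rightarrow> bool" where
  "is_basis n b U \<longleftrightarrow> inj_on b {1..n} \<and> independent (b ` {1..n}) \<and> span (b ` {1..n}) = U"

definition leaf_bases ::
    "(nat \<Rightarrow> 'a::real_vector set) \<Rightarrow> nat set \<Rightarrow> nat set set \<Rightarrow> (nat set \<Rightarrow> nat set set)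
      \<Rightarrow> (nat set \<Rightarrow> nat) \<Rightarrow> 'a tensor \<Rightarrow> (nat set \<Rightarrow> nat \<Rightarrow> 'a tensor) \<Rightarrow> bool" where
  "leaf_bases V D T S r v u \<longleftrightarrow> (\<forall>k\<in>leaves T S. is_basis (r k) (u k) (Umin V D k v))"

text \<open>
  The family \<open>w\<close> extends the given leaf vectors \<open>u\<close> to all vertices below the root. The transfer
  arrays \<open>C\<close> are unique relative to \<open>w\<close>; they cannot be unique in an absolute sense, since an inner
  vertex may be given any other basis of its minimal subspace. The array at an inner vertex \<open>\<mu>\<close>
  carries the index of \<open>\<mu>\<close> along with those of its sons, so that \<open>C (i(\<mu> := m))\<close> is the entry at
  \<open>m\<close> and \<open>i\<close>.
\<close>

definition tree_representation ::
    "(nat \<Rightarrow> 'a::real_vector set) \<Rightarrow> nat set \<Rightarrow> nat set set \<Rightarrow> (nat set \<Rightarrow> nat set set)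
      \<Rightarrow> (nat set \<Rightarrow> nat) \<Rightarrow> 'a tensor \<Rightarrow> (nat set \<Rightarrow> nat \<Rightarrow> 'a tensor) \<Rightarrow> bool" where
  "tree_representation V D T S r v u \<longleftrightarrow>
     (\<exists>w. (\<forall>k\<in>leaves T S. \<forall>i\<in>{1..r k}. w k i = u k i) \<and>
       (\<exists>!C. C \<in> full_rank_arrays (S D) r \<and>
         v = (\<Sum>i\<in>multi_indices (S D) r. C i *\<^sub>R (\<Prod>\<alpha>\<in>S D. w \<alpha> (i \<alpha>)))) \<and>
       (\<forall>\<mu>\<in>T - {D}. S \<mu> \<noteq> {} \<longrightarrow>
         (\<exists>!C. C \<in> arrays (insert \<mu> (S \<mu>)) r \<and>
           matricisation_rank \<mu> (insert \<mu> (S \<mu>)) r C = dim (Umin V D \<mu> v) \<and>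
           dim (Umin V D \<mu> v) = r \<mu> \<and>
           (\<forall>m\<in>{1..r \<mu>}. w \<mu> m =
             (\<Sum>i\<in>multi_indices (S \<mu>) r. C (i(\<mu> := m)) *\<^sub>R (\<Prod>\<beta>\<in>S \<mu>. w \<beta> (i \<beta>))))) \<and>
         is_basis (r \<mu>) (w \<mu>) (Umin V D \<mu> v)))"

end

theory Submission
  imports Defs
begin

text \<open>
  The minimal subspace of \<open>v\<close> at a vertex \<open>\<alpha>\<close> consists of the contractions of \<open>v\<close> by the linear
  functionals on the complementary factor \<open>V\<^sub>D\<^sub>-\<^sub>\<alpha>\<close> (\<open>Umin_eq_contractions\<close>). With this description the
  theorem becomes a matter of applying suitable functionals and projections to some of the factors.
  These maps exist by the universal property of the tensor product (\<open>tensor_lift_mult\<close>).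

  Suppose that \<open>v\<close> has tree-based rank \<open>r\<close>, and choose bases of its minimal subspaces, at the leaves
  the given ones. A contraction of \<open>v\<close> over the factors outside \<open>\<mu>\<close> does not affect the factors inside,
  so that an element of the minimal subspace at \<open>\<mu>\<close> belongs to \<open>U\<^sub>\<beta> \<otimes>\<^sub>a V\<^sub>\<mu>\<^sub>-\<^sub>\<beta>\<close> for every son \<open>\<beta>\<close>, where
  \<open>U\<^sub>\<beta>\<close> is the minimal subspace at \<open>\<beta>\<close> (\<open>Umin_nested\<close>). Projecting one son's factor after another shows
  that it lies in the span of the products of the bases at the sons (\<open>basis_products_expansion\<close>). This
  gives the transfer arrays. They are unique since the tensor products of dual functionals read off
  the coefficients (\<open>coefficients_unique\<close>).

  An array has full rank as soon as some linear image of its rows admits biorthogonal functionals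
  (\<open>matrix_rank_full\<close>). At an inner vertex the image of the rows is the chosen basis, which has dual
  functionals. For the matricisation of the root array at a son \<open>\<beta>\<close>, the required functionals are those whose
  contractions of \<open>v\<close> are the basis vectors of \<open>U\<^sub>\<beta>\<close> (\<open>root_coefficients_full_rank\<close>); here minimality
  of \<open>U\<^sub>\<beta>\<close> enters.

  Conversely, the bases in a representation fix the dimension at every vertex except the root. There
  the dimension only tells whether \<open>v = 0\<close>, and so does the vanishing of the dimension at a son of the
  root (\<open>dim_Umin_eq_0_iff\<close>). Since \<open>r\<close> is attained by some tensor, the value of \<open>r\<close> at the root is
  determined in the same way by its value at the son.
\<close>

section \<open>Linear maps induced by bilinear maps\<close>

text \<open>
  The class of one family, with its own domain as index set. This is the form in which the defining
  relations of multilinearity are stated.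
\<close>

definition class_of :: "(nat \<rightharpoonup> 'a::real_vector) \<Rightarrow> 'a tensor" where
  "class_of f = abs_tensor (Poly_Mapping.single f 1)"

lemma elem_tensor_class_of: "elem_tensor \<alpha> v = class_of ((\<lambda>j. Some (v j)) |` \<alpha>)"
  by (simp add: class_of_def elem_tensor.abs_eq)

lemma class_of_add: "class_of (f(j \<mapsto> x + y)) = class_of (f(j \<mapsto> x)) + class_of (f(j \<mapsto> y))"
proof -
  have "Poly_Mapping.single (f(j \<mapsto> x + y)) (1::real) - (Poly_Mapping.single (f(j \<mapsto> x)) 1
        + Poly_Mapping.single (f(j \<mapsto> y)) 1) \<in> tensor_relations"
    unfolding tensor_relations_def diff_diff_add[symmetric]
    by blast
  then show ?thesis
    unfolding class_of_def plus_tensor.abs_eq tensor.abs_eq_iff tensor_eq_def by (rule span_base)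
qed

lemma class_of_scale: "class_of (f(j \<mapsto> c *\<^sub>R x)) = c *\<^sub>R class_of (f(j \<mapsto> x))"
proof -
  have "Poly_Mapping.single (f(j \<mapsto> c *\<^sub>R x)) (1::real) - c *\<^sub>R Poly_Mapping.single (f(j \<mapsto> x)) 1
      \<in> tensor_relations"
    unfolding tensor_relations_def by blast
  then show ?thesis
    unfolding class_of_def scaleR_tensor.abs_eq tensor.abs_eq_iff tensor_eq_def by (rule span_base)
qed

text \<open>
  The linear map that a bilinear map \<open>B\<close> on \<open>V\<^sub>\<alpha> \<times> V\<^sub>\<beta>\<close> induces on \<open>V\<^sub>\<alpha>\<^sub>\<union>\<^sub>\<beta>\<close>. It is computed on a
  representative in the free vector space by cutting each family at \<open>\<alpha>\<close> and \<open>\<beta>\<close>. The type of tensors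
  is a direct sum over all index sets, and sending every other summand to \<open>0\<close> extends the map linearly
  to the whole type.
\<close>

definition tensor_lift ::
    "nat set \<Rightarrow> nat set \<Rightarrow> ('a::real_vector tensor \<Rightarrow> 'a tensor \<Rightarrow> 'b::real_vector) \<Rightarrow> 'a tensor \<Rightarrow> 'b" where
  "tensor_lift \<alpha> \<beta> B t = lin_ext (\<lambda>f.
     if dom f = \<alpha> \<union> \<beta> then B (class_of (f |` \<alpha>)) (class_of (f |` \<beta>)) else 0) (rep_tensor t)"

text \<open>
  The choice of representative does not matter: because \<open>\<alpha>\<close> and \<open>\<beta>\<close> are disjoint, changing a family
  at one index changes only one of its two pieces, so bilinearity of \<open>B\<close> makes the extension to the
  free vector space vanish on the relations of multilinearity.
\<close>

lemma tensor_lift_abs: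
  assumes B: "bilinear B" and disj: "\<alpha> \<inter> \<beta> = {}"
  shows "tensor_lift \<alpha> \<beta> B (abs_tensor p) = lin_ext (\<lambda>f.
     if dom f = \<alpha> \<union> \<beta> then B (class_of (f |` \<alpha>)) (class_of (f |` \<beta>)) else 0) p"
proof -
  define h where "h = (\<lambda>f. if dom f = \<alpha> \<union> \<beta> then B (class_of (f |` \<alpha>)) (class_of (f |` \<beta>)) else 0)"
  have lin: "linear (lin_ext h)" by (rule linear_lin_ext)
  have restr: "(f(j \<mapsto> x)) |` \<gamma> = (if j \<in> \<gamma> then (f |` \<gamma>)(j \<mapsto> x) else f |` \<gamma>)"
    for f :: "nat \<rightharpoonup> 'a" and j x and \<gamma> :: "nat set"
    by (auto simp: restrict_map_def fun_eq_iff)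
  have add: "h (f(j \<mapsto> x + y)) = h (f(j \<mapsto> x)) + h (f(j \<mapsto> y))" for f j x y
  proof (cases "insert j (dom f) = \<alpha> \<union> \<beta>")
    case True
    then have "j \<in> \<alpha> \<and> j \<notin> \<beta> \<or> j \<notin> \<alpha> \<and> j \<in> \<beta>" using disj by blast
    then show ?thesis using True
      by (auto simp: h_def restr class_of_add bilinear_ladd[OF B] bilinear_radd[OF B])
  qed (simp add: h_def)
  have scale: "h (f(j \<mapsto> c *\<^sub>R x)) = c *\<^sub>R h (f(j \<mapsto> x))" for f j c x
  proof (cases "insert j (dom f) = \<alpha> \<union> \<beta>")
    case True
    then have "j \<in> \<alpha> \<and> j \<notin> \<beta> \<or> j \<notin> \<alpha> \<and> j \<in> \<beta>" using disj by blast
    then show ?thesis using True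
      by (auto simp: h_def restr class_of_scale bilinear_lmul[OF B] bilinear_rmul[OF B])
  qed (simp add: h_def)
  have "lin_ext h t = 0" if "t \<in> tensor_relations" for t
    using that unfolding tensor_relations_def
    by (auto simp: linear_diff[OF lin] linear_scale[OF lin] add scale)
  then have z: "lin_ext h t = 0" if "t \<in> span tensor_relations" for t
    using linear_eq_0_on_span[OF lin] that by blast
  have "tensor_eq (rep_tensor (abs_tensor p)) p"
    by (rule Quotient3_rep_abs[OF Quotient3_tensor]) (rule tensor_eq_refl)
  then have "lin_ext h (rep_tensor (abs_tensor p) - p) = 0"
    unfolding tensor_eq_def by (rule z)
  then show ?thesis
    by (simp add: tensor_lift_def linear_diff[OF lin] flip: h_def)
qed

lemma linear_tensor_lift:
  assumes "bilinear B" "\<alpha> \<inter> \<beta> = {}"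
  shows "linear (tensor_lift \<alpha> \<beta> B)"
proof (rule linearI)
  fix s t :: "'a tensor" and c :: real
  obtain p q where s: "s = abs_tensor p" and t: "t = abs_tensor q"
    using Quotient3_abs_rep[OF Quotient3_tensor] by metis
  show "tensor_lift \<alpha> \<beta> B (s + t) = tensor_lift \<alpha> \<beta> B s + tensor_lift \<alpha> \<beta> B t"
    by (simp add: s t plus_tensor.abs_eq tensor_lift_abs[OF assms] linear_add[OF linear_lin_ext])
  show "tensor_lift \<alpha> \<beta> B (c *\<^sub>R s) = c *\<^sub>R tensor_lift \<alpha> \<beta> B s"
    by (simp add: s scaleR_tensor.abs_eq tensor_lift_abs[OF assms] linear_scale[OF linear_lin_ext])
qed

lemma tensor_lift_elem:
  assumes "bilinear B" "\<alpha> \<inter> \<beta> = {}"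
  shows "tensor_lift \<alpha> \<beta> B (elem_tensor \<alpha> v * elem_tensor \<beta> w) = B (elem_tensor \<alpha> v) (elem_tensor \<beta> w)"
proof -
  let ?f = "(\<lambda>j. Some (if j \<in> \<alpha> then v j else w j)) |` (\<alpha> \<union> \<beta>)"
  have "?f |` \<alpha> = (\<lambda>j. Some (v j)) |` \<alpha>" "?f |` \<beta> = (\<lambda>j. Some (w j)) |` \<beta>"
    using assms(2) by (auto simp: restrict_map_def fun_eq_iff)
  moreover have "dom ?f = \<alpha> \<union> \<beta>" by simp
  ultimately show ?thesis
    unfolding elem_tensor_mult[OF assms(2)] elem_tensor_class_of[of "\<alpha> \<union> \<beta>"]
    unfolding class_of_def[of ?f] tensor_lift_abs[OF assms]
    by (simp add: elem_tensor_class_of)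
qed

lemma bilinear_eq_on_span:
  assumes "bilinear B" "bilinear B'" "\<And>a b. a \<in> A \<Longrightarrow> b \<in> A' \<Longrightarrow> B a b = B' a b"
    and "x \<in> span A" "y \<in> span A'"
  shows "B x y = B' x y"
proof -
  have "B a y = B' a y" if "a \<in> A" for a
    by (rule linear_eq_on_span[of "B a" "B' a"])
       (use assms that in \<open>auto simp: bilinear_def\<close>)
  then show ?thesis
    by (intro linear_eq_on_span[of "\<lambda>x. B x y" "\<lambda>x. B' x y" A x])
       (use assms in \<open>auto simp: bilinear_def\<close>)
qed

lemma bilinear_tensor_mult: "bilinear ((*) :: 'a::real_vector tensor \<Rightarrow> _)"
  by (auto simp: bilinear_def intro!: linearI simp: distrib_left distrib_right)

text \<open>
  The universal property of \<open>V\<^sub>\<alpha>\<^sub>\<union>\<^sub>\<beta> = V\<^sub>\<alpha> \<otimes>\<^sub>a V\<^sub>\<beta>\<close>. All functionals, projections and contractions below are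
  obtained from it.
\<close>

lemma tensor_lift_mult:
  assumes B: "bilinear B" and disj: "\<alpha> \<inter> \<beta> = {}"
    and "x \<in> tensor_space V \<alpha>" "y \<in> tensor_space W \<beta>"
  shows "tensor_lift \<alpha> \<beta> B (x * y) = B x y"
proof (rule bilinear_eq_on_span[OF _ B _ assms(3,4)[unfolded tensor_space_def]])
  have "linear (\<lambda>y. x * y)" "linear (\<lambda>x. x * y)" for x y :: "'a tensor"
    using bilinear_tensor_mult by (auto simp: bilinear_def)
  then show "bilinear (\<lambda>x y. tensor_lift \<alpha> \<beta> B (x * y))"
    unfolding bilinear_def
    using linear_compose[OF _ linear_tensor_lift[OF B disj]] by (auto simp: o_def)
qed (auto simp: tensor_lift_elem[OF B disj])

section \<open>Products of subspaces\<close>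

lemma linear_tensor_mult: "linear (\<lambda>y. x * y)" "linear (\<lambda>x. x * y)" for x y :: "'a::real_vector tensor"
  using bilinear_tensor_mult by (auto simp: bilinear_def)

lemma subspace_tensor_space: "subspace (tensor_space V \<alpha>)"
  by (simp add: tensor_space_def)

lemma elem_tensor_in_tensor_space: "(\<And>j. j \<in> \<alpha> \<Longrightarrow> v j \<in> V j) \<Longrightarrow> elem_tensor \<alpha> v \<in> tensor_space V \<alpha>"
  unfolding tensor_space_def by (intro span_base CollectI exI[of _ v]) simp

text \<open>
  To place the image of a tensor in a subspace it is enough to look at products. Nested use of
  this rule replaces the explicit handling of sums of threefold products.
\<close>

lemma subspace_tensor_map:
  assumes "linear L" "subspace Z" "\<And>x y. x \<in> X \<Longrightarrow> y \<in> Y \<Longrightarrow> L (x * y) \<in> Z" "t \<in> X \<otimes>\<^sub>a Y"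
  shows "L t \<in> Z"
proof -
  have "{x * y | x y. x \<in> X \<and> y \<in> Y} \<subseteq> {t. L t \<in> Z}"
    using assms(3) by blast
  moreover have "subspace {t. L t \<in> Z}"
    using linear_subspace_vimage[OF assms(1,2)] by (simp add: vimage_def)
  ultimately have "X \<otimes>\<^sub>a Y \<subseteq> {t. L t \<in> Z}"
    unfolding subspace_tensor_def by (rule span_minimal)
  then show ?thesis using assms(4) by blast
qed

lemma subspace_tensor_eq:
  assumes "linear L" "linear L'" "\<And>x y. x \<in> X \<Longrightarrow> y \<in> Y \<Longrightarrow> L (x * y) = L' (x * y)" "t \<in> X \<otimes>\<^sub>a Y"
  shows "L t = L' t"
  by (rule linear_eq_on_span[OF assms(1,2) _ assms(4)[unfolded subspace_tensor_def]])
     (use assms(3) in blast)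

lemma subspace_tensor_subset:
  assumes "subspace Z" "\<And>x y. x \<in> X \<Longrightarrow> y \<in> Y \<Longrightarrow> x * y \<in> Z"
  shows "X \<otimes>\<^sub>a Y \<subseteq> Z"
  unfolding subspace_tensor_def by (rule span_minimal) (use assms in blast)+

lemma subspace_tensor_base: "x \<in> X \<Longrightarrow> y \<in> Y \<Longrightarrow> x * y \<in> X \<otimes>\<^sub>a Y"
  unfolding subspace_tensor_def by (rule span_base) blast

lemma subspace_subspace_tensor: "subspace (X \<otimes>\<^sub>a Y)"
  unfolding subspace_tensor_def by (rule subspace_span)

lemma span_mult_span:
  fixes A B C :: "'a::real_vector tensor set"
  assumes "x \<in> span A" "y \<in> span B" "subspace Z" "\<And>a b. a \<in> A \<Longrightarrow> b \<in> B \<Longrightarrow> a * b \<in> Z"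
  shows "x * y \<in> Z"
proof -
  have 1: "a * y \<in> Z" if "a \<in> A" for a
    using span_minimal[of B "(*) a -` Z"] linear_subspace_vimage[OF linear_tensor_mult(1) assms(3)]
      assms(2,4) that by blast
  show ?thesis
    using span_minimal[of A "(\<lambda>x. x * y) -` Z"] linear_subspace_vimage[OF linear_tensor_mult(2) assms(3)]
      assms(1) 1 by blast
qed

lemma tensor_space_mult:
  assumes "\<alpha> \<inter> \<beta> = {}" "x \<in> tensor_space V \<alpha>" "y \<in> tensor_space V \<beta>"
  shows "x * y \<in> tensor_space V (\<alpha> \<union> \<beta>)"
  by (rule span_mult_span[OF assms(2,3)[unfolded tensor_space_def] subspace_tensor_space])
     (auto simp: elem_tensor_mult[OF assms(1)] intro!: elem_tensor_in_tensor_space)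

text \<open>
  The identification of \<open>V\<^sub>\<alpha>\<^sub>\<union>\<^sub>\<beta>\<close> with \<open>V\<^sub>\<alpha> \<otimes>\<^sub>a V\<^sub>\<beta>\<close>: an elementary tensor over a disjoint union is the
  product of its two restrictions.
\<close>

lemma tensor_space_union:
  assumes "\<alpha> \<inter> \<beta> = {}"
  shows "tensor_space V (\<alpha> \<union> \<beta>) = tensor_space V \<alpha> \<otimes>\<^sub>a tensor_space V \<beta>"
proof
  show "tensor_space V (\<alpha> \<union> \<beta>) \<subseteq> tensor_space V \<alpha> \<otimes>\<^sub>a tensor_space V \<beta>"
    unfolding tensor_space_def[of V "\<alpha> \<union> \<beta>"]
  proof (rule span_minimal[OF _ subspace_subspace_tensor], clarify)
    fix v assume "\<forall>j\<in>\<alpha> \<union> \<beta>. v j \<in> V j"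
    then have "elem_tensor \<alpha> v * elem_tensor \<beta> v \<in> tensor_space V \<alpha> \<otimes>\<^sub>a tensor_space V \<beta>"
      by (intro subspace_tensor_base elem_tensor_in_tensor_space) auto
    then show "elem_tensor (\<alpha> \<union> \<beta>) v \<in> tensor_space V \<alpha> \<otimes>\<^sub>a tensor_space V \<beta>"
      by (simp add: elem_tensor_mult[OF assms])
  qed
qed (intro subspace_tensor_subset subspace_tensor_space tensor_space_mult[OF assms])

lemma elem_tensor_empty: "elem_tensor {} v = 1"
  by transfer (simp add: tensor_eq_refl)

lemma tensor_space_empty: "tensor_space V {} = span {1}"
  by (simp add: tensor_space_def elem_tensor_empty)

text \<open>
  Expanding all second factors in one basis of \<open>Y\<close> and collecting terms makes the second factors
  linearly independent, so that dual functionals can isolate the first factors.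
\<close>

lemma subspace_tensor_representation:
  assumes X: "subspace X" and t: "t \<in> X \<otimes>\<^sub>a Y"
  obtains F x where "finite F" "F \<subseteq> Y" "independent F" "\<And>y. y \<in> F \<Longrightarrow> x y \<in> X" "t = (\<Sum>y\<in>F. x y * y)"
proof -
  obtain B where B: "B \<subseteq> Y" "independent B" "Y \<subseteq> span B"
    by (rule basis_exists[of Y])
  have "\<exists>F x. finite F \<and> F \<subseteq> B \<and> (\<forall>y. x y \<in> X) \<and> t = (\<Sum>y\<in>F. x y * y)"
    using t unfolding subspace_tensor_def
  proof (induction rule: span_induct_alt)
    case base
    show ?case using subspace_0[OF X] by (intro exI[of _ "{}"] exI[of _ "\<lambda>_. 0"]) auto
  next
    case (step c z t)
    obtain a y where z: "z = a * y" "a \<in> X" "y \<in> Y" using step(1) by blast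
    obtain F g where F: "finite F" "F \<subseteq> B" "y = (\<Sum>b\<in>F. g b *\<^sub>R b)"
    proof -
      have "y \<in> {\<Sum>a\<in>t. r a *\<^sub>R a | t r. finite t \<and> t \<subseteq> B}"
        using z(3) B(3) unfolding span_explicit by (rule rev_subsetD)
      then show thesis using that by blast
    qed
    obtain F' x where F': "finite F'" "F' \<subseteq> B" "\<forall>y. x y \<in> X" "t = (\<Sum>y\<in>F'. x y * y)"
      using step(2) by blast
    \<comment> \<open>Both sums are extended by zero to the common index set \<open>F \<union> F'\<close> before they are added.\<close>
    let ?x = "\<lambda>b. (if b \<in> F then (c * g b) *\<^sub>R a else 0) + (if b \<in> F' then x b else 0)"
    have "c *\<^sub>R z = (\<Sum>b\<in>F. ((c * g b) *\<^sub>R a) * b)"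
      by (simp add: z F(3) sum_distrib_left scaleR_sum_right)
    also have "\<dots> = (\<Sum>b\<in>F \<union> F'. (if b \<in> F then (c * g b) *\<^sub>R a else 0) * b)"
      using F(1) F'(1) by (intro sum.mono_neutral_cong_left) auto
    finally have 1: "c *\<^sub>R z = (\<Sum>b\<in>F \<union> F'. (if b \<in> F then (c * g b) *\<^sub>R a else 0) * b)" .
    have 2: "t = (\<Sum>b\<in>F \<union> F'. (if b \<in> F' then x b else 0) * b)"
      unfolding F'(4) using F(1) F'(1) by (intro sum.mono_neutral_cong_left) auto
    have "c *\<^sub>R z + t = (\<Sum>b\<in>F \<union> F'. ?x b * b)"
      by (subst 1, subst 2) (simp only: sum.distrib distrib_right)
    moreover have "\<forall>b. ?x b \<in> X"
      using F'(3) X z(2) by (auto intro!: subspace_add subspace_scale subspace_0)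
    ultimately show ?case
      using F(1,2) F'(1,2) by (intro exI[of _ "F \<union> F'"] exI[of _ ?x] conjI) simp_all
  qed
  then obtain F x where F: "finite F" "F \<subseteq> B" "\<forall>y. x y \<in> X" "t = (\<Sum>y\<in>F. x y * y)"
    by blast
  show thesis
    by (rule that[of F x]) (use F B(1) independent_mono[OF B(2) F(2)] in auto)
qed

section \<open>Minimal subspaces as sets of contractions\<close>

text \<open>
  The partial evaluation \<open>id \<otimes> \<phi>\<close> from \<open>V\<^sub>\<alpha>\<^sub>\<union>\<^sub>\<beta>\<close> to \<open>V\<^sub>\<alpha>\<close>.
\<close>

definition contraction :: "nat set \<Rightarrow> nat set \<Rightarrow> ('a::real_vector tensor \<Rightarrow> real) \<Rightarrow> 'a tensor \<Rightarrow> 'a tensor" where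
  "contraction \<alpha> \<beta> \<phi> = tensor_lift \<alpha> \<beta> (\<lambda>x y. \<phi> y *\<^sub>R x)"

context
  fixes \<phi> :: "'a::real_vector tensor \<Rightarrow> real" and \<alpha> \<beta> :: "nat set"
  assumes \<phi>: "linear \<phi>" and disj: "\<alpha> \<inter> \<beta> = {}"
begin

lemma bilinear_contraction: "bilinear (\<lambda>x y. \<phi> y *\<^sub>R (x :: 'a tensor))"
  by (auto simp: bilinear_def linear_iff linear_add[OF \<phi>] linear_scale[OF \<phi>] algebra_simps)

lemma linear_contraction: "linear (contraction \<alpha> \<beta> \<phi>)"
  unfolding contraction_def by (rule linear_tensor_lift[OF bilinear_contraction disj])

lemma contraction_mult:
  "x \<in> tensor_space V \<alpha> \<Longrightarrow> y \<in> tensor_space W \<beta> \<Longrightarrow> contraction \<alpha> \<beta> \<phi> (x * y) = \<phi> y *\<^sub>R x"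
  unfolding contraction_def by (rule tensor_lift_mult[OF bilinear_contraction disj])

lemma contraction_in:
  assumes "subspace X" "X \<subseteq> tensor_space V \<alpha>" "t \<in> X \<otimes>\<^sub>a tensor_space W \<beta>"
  shows "contraction \<alpha> \<beta> \<phi> t \<in> X"
  by (rule subspace_tensor_map[OF linear_contraction assms(1) _ assms(3)])
     (use assms(1,2) in \<open>auto simp: contraction_mult subset_iff subspace_scale\<close>)

end

lemma dual_functionals:
  fixes B :: "'b::real_vector set"
  assumes "independent B" "b \<in> B"
  obtains \<phi> :: "'b \<Rightarrow> real" where "linear \<phi>" "\<And>c. c \<in> B \<Longrightarrow> \<phi> c = of_bool (c = b)"
  using linear_independent_extend[OF assms(1), of "\<lambda>c. of_bool (c = b) :: real"] by metis

text \<open>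
  In a representation of \<open>v\<close> with linearly independent second factors, the functional dual to one of
  the factors contracts \<open>v\<close> to the first factor that accompanies it. Hence the finitely many first
  factors are themselves contractions of \<open>v\<close>.
\<close>

lemma contractions_finitely_spanned:
  assumes disj: "\<alpha> \<inter> \<beta> = {}" and v: "v \<in> tensor_space V (\<alpha> \<union> \<beta>)"
  obtains F where "finite F" "F \<subseteq> {contraction \<alpha> \<beta> \<phi> v | \<phi>. linear \<phi>}"
    "v \<in> span F \<otimes>\<^sub>a tensor_space V \<beta>" "span F \<subseteq> tensor_space V \<alpha>"
proof -
  obtain G x where G: "finite G" "G \<subseteq> tensor_space V \<beta>" "independent G"
    "\<And>y. y \<in> G \<Longrightarrow> x y \<in> tensor_space V \<alpha>" "v = (\<Sum>y\<in>G. x y * y)"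
    using subspace_tensor_representation[OF subspace_tensor_space
        v[unfolded tensor_space_union[OF disj]]] by blast
  have "x y \<in> {contraction \<alpha> \<beta> \<phi> v | \<phi>. linear \<phi>}" if y: "y \<in> G" for y
  proof -
    obtain \<phi> :: "'a tensor \<Rightarrow> real" where \<phi>: "linear \<phi>" "\<And>c. c \<in> G \<Longrightarrow> \<phi> c = of_bool (c = y)"
      using dual_functionals[OF G(3) y] by blast
    have "contraction \<alpha> \<beta> \<phi> v = (\<Sum>c\<in>G. contraction \<alpha> \<beta> \<phi> (x c * c))"
      unfolding G(5) by (rule linear_sum[OF linear_contraction[OF \<phi>(1) disj]])
    also have "\<dots> = (\<Sum>c\<in>G. \<phi> c *\<^sub>R x c)"
      using G(2,4) by (intro sum.cong refl contraction_mult[OF \<phi>(1) disj]) auto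
    also have "\<dots> = (\<Sum>c\<in>G. if c = y then x c else 0)"
      by (rule sum.cong) (auto simp: \<phi>(2))
    also have "\<dots> = x y" using G(1) y by simp
    finally show ?thesis using \<phi>(1) by (auto intro!: exI[of _ \<phi>])
  qed
  moreover have "v \<in> span (x ` G) \<otimes>\<^sub>a tensor_space V \<beta>"
    unfolding G(5) using G(2)
    by (intro subspace_sum[OF subspace_subspace_tensor] subspace_tensor_base) (auto intro: span_base)
  moreover have "span (x ` G) \<subseteq> tensor_space V \<alpha>"
    using G(4) by (intro span_minimal subspace_tensor_space) auto
  ultimately show thesis using that[of "x ` G"] G(1) by blast
qed

text \<open>
  Minimality holds because contracting an element of \<open>W \<otimes>\<^sub>a V\<^sub>\<beta>\<close> can only give elements of \<open>W\<close>. Applied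
  to the span of the finitely many first factors of a representation of \<open>v\<close>, it also shows that the
  contractions span a finite-dimensional space.
\<close>

lemma contractions_minimal_subspace:
  fixes v :: "'a::real_vector tensor"
  assumes disj: "\<alpha> \<inter> \<beta> = {}" and v: "v \<in> tensor_space V (\<alpha> \<union> \<beta>)"
  defines "U \<equiv> {contraction \<alpha> \<beta> \<phi> v | \<phi>. linear \<phi>}"
  shows "subspace U" "U \<subseteq> tensor_space V \<alpha>" "v \<in> U \<otimes>\<^sub>a tensor_space V \<beta>"
    "\<And>W. subspace W \<Longrightarrow> W \<subseteq> tensor_space V \<alpha> \<Longrightarrow> v \<in> W \<otimes>\<^sub>a tensor_space V \<beta> \<Longrightarrow> U \<subseteq> W"
    "\<exists>F. finite F \<and> U = span F"
proof -
  show least: "U \<subseteq> W" if "subspace W" "W \<subseteq> tensor_space V \<alpha>" "v \<in> W \<otimes>\<^sub>a tensor_space V \<beta>" for W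
    unfolding U_def using contraction_in[OF _ disj that] by blast
  obtain F where F: "finite F" "F \<subseteq> U" "v \<in> span F \<otimes>\<^sub>a tensor_space V \<beta>" "span F \<subseteq> tensor_space V \<alpha>"
    using contractions_finitely_spanned[OF disj v] unfolding U_def by blast
  have le: "U \<subseteq> span F"
    using F(3,4) by (intro least) auto
  \<comment> \<open>Contraction depends linearly on the functional, as one sees on products.\<close>
  show sub: "subspace U"
  proof (rule subspaceI)
    have v': "v \<in> tensor_space V \<alpha> \<otimes>\<^sub>a tensor_space V \<beta>"
      using v tensor_space_union[OF disj] by blast
    have lin0: "linear (\<lambda>_ :: 'a tensor. 0 :: real)" by (rule linear_zero)
    have "contraction \<alpha> \<beta> (\<lambda>_. 0) v = 0"
      by (rule subspace_tensor_eq[OF linear_contraction[OF lin0 disj] linear_zero _ v'])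
         (simp add: contraction_mult[OF lin0 disj])
    then show "0 \<in> U" unfolding U_def using lin0 by force
    fix x y and c :: real assume "x \<in> U" "y \<in> U"
    then obtain \<phi> \<psi> where *: "x = contraction \<alpha> \<beta> \<phi> v" "linear \<phi>" "y = contraction \<alpha> \<beta> \<psi> v" "linear \<psi>"
      unfolding U_def by blast
    have lin: "linear (\<lambda>t. \<phi> t + \<psi> t)" "linear (\<lambda>t. c * \<phi> t)"
      using linear_compose_add[OF *(2,4)] linear_compose_scale_right[OF *(2), of c] by simp_all
    have "contraction \<alpha> \<beta> (\<lambda>t. \<phi> t + \<psi> t) v = contraction \<alpha> \<beta> \<phi> v + contraction \<alpha> \<beta> \<psi> v"
      by (rule subspace_tensor_eq[OF linear_contraction[OF lin(1) disj]
            linear_compose_add[OF linear_contraction[OF *(2) disj] linear_contraction[OF *(4) disj]] _ v'])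
         (simp add: contraction_mult[OF lin(1) disj] contraction_mult[OF *(2) disj]
           contraction_mult[OF *(4) disj] scaleR_left_distrib)
    then show "x + y \<in> U" unfolding U_def using * lin(1) by force
    have "contraction \<alpha> \<beta> (\<lambda>t. c * \<phi> t) v = c *\<^sub>R contraction \<alpha> \<beta> \<phi> v"
      by (rule subspace_tensor_eq[OF linear_contraction[OF lin(2) disj]
            linear_compose_scale_right[OF linear_contraction[OF *(2) disj]] _ v'])
         (simp add: contraction_mult[OF lin(2) disj] contraction_mult[OF *(2) disj])
    then show "c *\<^sub>R x \<in> U" unfolding U_def using * lin(2) by force
  qed
  have eq: "U = span F"
    using le span_minimal[OF F(2) sub] by blast
  show "U \<subseteq> tensor_space V \<alpha>" "v \<in> U \<otimes>\<^sub>a tensor_space V \<beta>" "\<exists>F. finite F \<and> U = span F"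
    using F eq by auto
qed

text \<open>
  For \<open>\<alpha> = D\<close>, where the minimal subspace is the span of \<open>v\<close> by convention, the same formula holds:
  the complementary factor \<open>V\<^sub>\<emptyset>\<close> is the line spanned by \<open>1\<close>, and contraction multiplies \<open>v\<close> by
  \<open>\<phi> 1\<close>. Thus the root of a tree can be treated like the other vertices.
\<close>

lemma Umin_eq_contractions:
  assumes \<alpha>: "\<alpha> \<subseteq> D" and v: "v \<in> tensor_space V D"
  shows "Umin V D \<alpha> v = {contraction \<alpha> (D - \<alpha>) \<phi> v | \<phi>. linear \<phi>}" (is "_ = ?U")
proof (cases "\<alpha> = D")
  case True
  have 1: "contraction D {} \<phi> v = \<phi> 1 *\<^sub>R v" if "linear \<phi>" for \<phi>
    using contraction_mult[OF that, of D "{}" v V 1 V] v by (simp add: tensor_space_empty span_base)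
  obtain \<phi> :: "'a tensor \<Rightarrow> real" where \<phi>: "linear \<phi>" "\<phi> 1 = 1"
    using dual_functionals[of "{1 :: 'a tensor}" 1] by auto
  have "c *\<^sub>R v \<in> ?U" for c
  proof -
    have "linear (\<lambda>t. c * \<phi> t)" using linear_compose_scale_right[OF \<phi>(1), of c] by simp
    then show ?thesis using 1[of "\<lambda>t. c * \<phi> t"] \<phi>(2) True by force
  qed
  then show ?thesis
    using 1 True by (auto simp: Umin_def span_singleton)
next
  case False
  have D: "\<alpha> \<inter> (D - \<alpha>) = {}" "\<alpha> \<union> (D - \<alpha>) = D" using \<alpha> by auto
  note U = contractions_minimal_subspace[OF D(1), of v V, unfolded D(2), OF v]
  have "(THE U. subspace U \<and> U \<subseteq> tensor_space V \<alpha> \<and> v \<in> U \<otimes>\<^sub>a tensor_space V (D - \<alpha>) \<and>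
      (\<forall>W. subspace W \<and> W \<subseteq> tensor_space V \<alpha> \<and> v \<in> W \<otimes>\<^sub>a tensor_space V (D - \<alpha>) \<longrightarrow> U \<subseteq> W)) = ?U"
  proof (rule the_equality, intro conjI allI impI U(1-3))
    fix W assume "subspace W \<and> W \<subseteq> tensor_space V \<alpha> \<and> v \<in> W \<otimes>\<^sub>a tensor_space V (D - \<alpha>)"
    then show "?U \<subseteq> W" by (intro U(4)) simp_all
  next
    fix W assume W: "subspace W \<and> W \<subseteq> tensor_space V \<alpha> \<and> v \<in> W \<otimes>\<^sub>a tensor_space V (D - \<alpha>) \<and>
      (\<forall>W'. subspace W' \<and> W' \<subseteq> tensor_space V \<alpha> \<and> v \<in> W' \<otimes>\<^sub>a tensor_space V (D - \<alpha>) \<longrightarrow> W \<subseteq> W')"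
    show "W = ?U"
    proof (rule equalityI)
      show "W \<subseteq> ?U" using W U(1-3) by simp
      show "?U \<subseteq> W" using W by (intro U(4)) simp_all
    qed
  qed
  then show ?thesis
    unfolding Umin_def using False by simp
qed

context
  fixes V :: "nat \<Rightarrow> 'a::real_vector set" and \<alpha> D :: "nat set" and v :: "'a tensor"
  assumes \<alpha>: "\<alpha> \<subseteq> D" and v: "v \<in> tensor_space V D"
begin

lemma
  shows subspace_Umin: "subspace (Umin V D \<alpha> v)"
    and Umin_subset: "Umin V D \<alpha> v \<subseteq> tensor_space V \<alpha>"
    and Umin_mem: "v \<in> Umin V D \<alpha> v \<otimes>\<^sub>a tensor_space V (D - \<alpha>)"
    and Umin_finite_span: "\<exists>F. finite F \<and> Umin V D \<alpha> v = span F"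
proof -
  have D: "\<alpha> \<inter> (D - \<alpha>) = {}" "\<alpha> \<union> (D - \<alpha>) = D" using \<alpha> by auto
  show "subspace (Umin V D \<alpha> v)" "Umin V D \<alpha> v \<subseteq> tensor_space V \<alpha>"
    "v \<in> Umin V D \<alpha> v \<otimes>\<^sub>a tensor_space V (D - \<alpha>)" "\<exists>F. finite F \<and> Umin V D \<alpha> v = span F"
    unfolding Umin_eq_contractions[OF \<alpha> v]
    using contractions_minimal_subspace(1,2,3,5)[OF D(1), of v V, unfolded D(2), OF v] by this
qed

end

section \<open>Bases, dual functionals and ranks\<close>

lemma is_basis_exists:
  fixes U :: "'b::real_vector set"
  assumes "finite F" "U = span F"
  obtains b where "is_basis (dim U) b U"
proof -
  obtain B where B: "B \<subseteq> U" "independent B" "U \<subseteq> span B" "card B = dim U"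
    by (rule basis_exists[of U])
  have "finite B"
    using independent_span_bound[OF assms(1) B(2)] B(1) assms(2) by simp
  then obtain b where b: "bij_betw b {1..dim U} B"
    using ex_bij_betw_nat_finite_1 B(4) by metis
  have "span B = U"
    using B(1,3) assms(2) by (simp add: span_minimal subset_antisym)
  then show thesis
    using b B(2) that[of b] by (simp add: is_basis_def bij_betw_def)
qed

lemma is_basis_dim: "is_basis n b U \<Longrightarrow> dim U = n"
  unfolding is_basis_def using dim_span_eq_card_independent[of "b ` {1..n}"] card_image[of b "{1..n}"]
  by simp

lemma is_basis_mem: "is_basis n b U \<Longrightarrow> m \<in> {1..n} \<Longrightarrow> b m \<in> U"
  unfolding is_basis_def by (auto intro: span_base)

lemma is_basis_dual:
  fixes b :: "nat \<Rightarrow> 'b::real_vector"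
  assumes "is_basis n b U" "m \<in> {1..n}"
  obtains \<phi> :: "'b \<Rightarrow> real" where "linear \<phi>" "\<And>k. k \<in> {1..n} \<Longrightarrow> \<phi> (b k) = of_bool (k = m)"
proof -
  have b: "independent (b ` {1..n})" "inj_on b {1..n}" using assms(1) by (simp_all add: is_basis_def)
  obtain \<phi> :: "'b \<Rightarrow> real" where \<phi>: "linear \<phi>" "\<And>c. c \<in> b ` {1..n} \<Longrightarrow> \<phi> c = of_bool (c = b m)"
    using dual_functionals[OF b(1)] assms(2) by blast
  show thesis
    by (rule that[OF \<phi>(1)]) (use \<phi>(2) b(2) assms(2) in \<open>simp add: inj_on_eq_iff\<close>)
qed

text \<open>
  Full ranks are established through this criterion: functionals that are biorthogonal to a family
  show at once that its members are distinct and linearly independent.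
\<close>

lemma dim_biorthogonal:
  fixes b :: "nat \<Rightarrow> 'b::real_vector" and \<phi> :: "nat \<Rightarrow> 'b \<Rightarrow> real"
  assumes lin: "\<And>m. m \<in> {1..n} \<Longrightarrow> linear (\<phi> m)"
    and dual: "\<And>m k. m \<in> {1..n} \<Longrightarrow> k \<in> {1..n} \<Longrightarrow> \<phi> m (b k) = of_bool (k = m)"
  shows "dim (b ` {1..n}) = n"
proof -
  have inj: "inj_on b {1..n}"
  proof (rule inj_onI)
    fix k m assume "k \<in> {1..n}" "m \<in> {1..n}" "b k = b m"
    then show "k = m" using dual[of m k] dual[of m m] by auto
  qed
  have "independent (b ` {1..n})"
  proof (rule independent_if_scalars_zero)
    fix f x assume sum: "(\<Sum>x\<in>b ` {1..n}. f x *\<^sub>R x) = 0" and "x \<in> b ` {1..n}"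
    then obtain m where m: "m \<in> {1..n}" "x = b m" by blast
    have "0 = \<phi> m (\<Sum>k\<in>{1..n}. f (b k) *\<^sub>R b k)"
      using linear_0[OF lin[OF m(1)]] sum[unfolded sum.reindex[OF inj] o_def] by (simp only:)
    also have "\<dots> = (\<Sum>k\<in>{1..n}. f (b k) * \<phi> m (b k))"
      by (simp add: linear_sum[OF lin[OF m(1)]] linear_scale[OF lin[OF m(1)]])
    also have "\<dots> = (\<Sum>k\<in>{1..n}. if k = m then f (b k) else 0)"
      by (rule sum.cong) (simp_all add: dual[OF m(1)])
    finally show "f x = 0" using m by simp
  qed simp
  then show ?thesis
    using inj by (simp add: dim_eq_card_independent card_image)
qed

text \<open>
  The combinations of vectors \<open>h j\<close> with the entries of a row as coefficients are the image of the
  row under one linear map. Functionals biorthogonal to these combinations pull back to functionals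
  biorthogonal to the rows.
\<close>

lemma matrix_rank_full:
  fixes h :: "'c \<Rightarrow> 'b::real_vector" and \<phi> :: "nat \<Rightarrow> 'b \<Rightarrow> real"
  assumes lin: "\<And>m. m \<in> {1..n} \<Longrightarrow> linear (\<phi> m)"
    and dual: "\<And>m k. m \<in> {1..n} \<Longrightarrow> k \<in> {1..n} \<Longrightarrow> \<phi> m (\<Sum>j\<in>J. M k j *\<^sub>R h j) = of_bool (k = m)"
  shows "matrix_rank {1..n} J M = n"
proof -
  have R: "lin_ext h (matrix_row J a) = (\<Sum>j\<in>J. a j *\<^sub>R h j)" for a
    unfolding matrix_row_def by (simp add: linear_sum[OF linear_lin_ext])
  show ?thesis
    unfolding matrix_rank_def
  proof (rule dim_biorthogonal[where \<phi> = "\<lambda>m x. \<phi> m (lin_ext h x)"])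
    show "linear (\<lambda>x. \<phi> m (lin_ext h x))" if "m \<in> {1..n}" for m
      using linear_compose[OF linear_lin_ext lin[OF that]] by (simp add: o_def)
  qed (simp add: R dual)
qed

section \<open>Multi-indices\<close>

lemma finite_multi_indices: "finite A \<Longrightarrow> finite (multi_indices A r)"
  by (simp add: multi_indices_def finite_PiE)

lemma multi_indices_mem: "i \<in> multi_indices A r \<Longrightarrow> \<beta> \<in> A \<Longrightarrow> i \<beta> \<in> {1..r \<beta>}"
  unfolding multi_indices_def by (rule PiE_mem)

lemma multi_indices_insert:
  "multi_indices (insert \<gamma> A) r = (\<lambda>(m, i). i(\<gamma> := m)) ` ({1..r \<gamma>} \<times> multi_indices A r)"
  unfolding multi_indices_def by (rule PiE_insert_eq)

lemma sum_multi_indices_insert: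
  assumes "\<gamma> \<notin> A"
  shows "(\<Sum>i\<in>multi_indices (insert \<gamma> A) r. f i) = (\<Sum>m\<in>{1..r \<gamma>}. \<Sum>i\<in>multi_indices A r. f (i(\<gamma> := m)))"
proof -
  have "inj_on (\<lambda>(m, i). i(\<gamma> := m)) ({1..r \<gamma>} \<times> multi_indices A r)"
    unfolding multi_indices_def by (rule inj_combinator[OF assms])
  then show ?thesis
    unfolding multi_indices_insert by (subst sum.reindex) (auto simp: sum.cartesian_product split_def)
qed

section \<open>Products over disjoint index sets\<close>

lemma prod_in_tensor_space:
  assumes "finite A" "disjoint A" "\<And>\<beta>. \<beta> \<in> A \<Longrightarrow> x \<beta> \<in> tensor_space V \<beta>"
  shows "(\<Prod>\<beta>\<in>A. x \<beta>) \<in> tensor_space V (\<Union>A)"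
  using assms
proof (induction A rule: finite_induct)
  case empty
  show ?case by (simp add: tensor_space_empty span_base)
next
  case (insert \<gamma> A)
  have "\<gamma> \<inter> \<Union>A = {}"
    using insert.prems(1) insert.hyps(2) by (auto simp: pairwise_insert disjnt_def)
  then have "x \<gamma> * (\<Prod>\<beta>\<in>A. x \<beta>) \<in> tensor_space V (\<gamma> \<union> \<Union>A)"
    using insert by (intro tensor_space_mult insert.IH) (auto simp: pairwise_insert)
  then show ?case using insert.hyps by simp
qed

text \<open>
  The tensor product of the functionals \<open>\<phi> \<beta>\<close>, built by the universal property one factor at a time.
\<close>

lemma product_functional:
  fixes \<phi> :: "nat set \<Rightarrow> 'a::real_vector tensor \<Rightarrow> real"
  assumes "finite A" "disjoint A" "\<And>\<beta>. \<beta> \<in> A \<Longrightarrow> linear (\<phi> \<beta>)"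
  shows "\<exists>\<Phi>. linear \<Phi> \<and> (\<forall>x. (\<forall>\<beta>\<in>A. x \<beta> \<in> tensor_space V \<beta>) \<longrightarrow> \<Phi> (\<Prod>\<beta>\<in>A. x \<beta>) = (\<Prod>\<beta>\<in>A. \<phi> \<beta> (x \<beta>)))"
  using assms
proof (induction A rule: finite_induct)
  case empty
  obtain \<Phi> :: "'a tensor \<Rightarrow> real" where "linear \<Phi>" "\<Phi> 1 = 1"
    using dual_functionals[of "{1 :: 'a tensor}" 1] by auto
  then show ?case by auto
next
  case (insert \<gamma> A)
  have disj: "\<gamma> \<inter> \<Union>A = {}" "disjoint A"
    using insert.prems(1) insert.hyps(2) by (auto simp: disjoint_def)
  obtain \<Phi> where \<Phi>: "linear \<Phi>"
    "\<And>x. \<forall>\<beta>\<in>A. x \<beta> \<in> tensor_space V \<beta> \<Longrightarrow> \<Phi> (\<Prod>\<beta>\<in>A. x \<beta>) = (\<Prod>\<beta>\<in>A. \<phi> \<beta> (x \<beta>))"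
    using insert.IH[OF disj(2)] insert.prems(2) by auto
  have \<phi>: "linear (\<phi> \<gamma>)" using insert.prems(2) by simp
  have bil: "bilinear (\<lambda>x y. \<phi> \<gamma> x * \<Phi> y)"
    by (auto simp: bilinear_def linear_iff linear_add[OF \<phi>] linear_scale[OF \<phi>]
        linear_add[OF \<Phi>(1)] linear_scale[OF \<Phi>(1)] algebra_simps)
  let ?\<Psi> = "tensor_lift \<gamma> (\<Union>A) (\<lambda>x y. \<phi> \<gamma> x * \<Phi> y)"
  have "?\<Psi> (\<Prod>\<beta>\<in>insert \<gamma> A. x \<beta>) = (\<Prod>\<beta>\<in>insert \<gamma> A. \<phi> \<beta> (x \<beta>))"
    if x: "\<forall>\<beta>\<in>insert \<gamma> A. x \<beta> \<in> tensor_space V \<beta>" for x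
  proof -
    have "?\<Psi> (x \<gamma> * (\<Prod>\<beta>\<in>A. x \<beta>)) = \<phi> \<gamma> (x \<gamma>) * \<Phi> (\<Prod>\<beta>\<in>A. x \<beta>)"
      using x by (intro tensor_lift_mult[OF bil disj(1)] prod_in_tensor_space insert.hyps disj(2)) auto
    then show ?thesis
      using x \<Phi>(2)[of x] insert.hyps by simp
  qed
  then show ?case
    using linear_tensor_lift[OF bil disj(1)] by blast
qed

text \<open>
  The tensor product of the functionals dual to the basis vectors selected by \<open>i\<close> picks the coefficient
  at the multi-index \<open>i\<close>. In particular the products of basis vectors are linearly independent.
\<close>

lemma coefficient_functional:
  assumes A: "finite A" "disjoint A"
    and basis: "\<And>\<beta>. \<beta> \<in> A \<Longrightarrow> is_basis (r \<beta>) (w \<beta>) (U \<beta>)"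
    and U: "\<And>\<beta>. \<beta> \<in> A \<Longrightarrow> U \<beta> \<subseteq> tensor_space V \<beta>"
    and i: "i \<in> multi_indices A r"
  obtains \<Phi> :: "'a::real_vector tensor \<Rightarrow> real" where "linear \<Phi>"
    "\<And>j. j \<in> multi_indices A r \<Longrightarrow> \<Phi> (\<Prod>\<beta>\<in>A. w \<beta> (j \<beta>)) = of_bool (j = i)"
proof -
  have i': "i \<beta> \<in> {1..r \<beta>}" if "\<beta> \<in> A" for \<beta>
    using i that by (rule multi_indices_mem)
  have "\<exists>\<phi> :: 'a tensor \<Rightarrow> real. linear \<phi> \<and> (\<forall>k\<in>{1..r \<beta>}. \<phi> (w \<beta> k) = of_bool (k = i \<beta>))" if "\<beta> \<in> A" for \<beta>
    using is_basis_dual[OF basis[OF that] i'[OF that]] by metis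
  then obtain \<phi> :: "nat set \<Rightarrow> 'a tensor \<Rightarrow> real" where \<phi>: "\<And>\<beta>. \<beta> \<in> A \<Longrightarrow> linear (\<phi> \<beta>)"
    "\<And>\<beta> k. \<beta> \<in> A \<Longrightarrow> k \<in> {1..r \<beta>} \<Longrightarrow> \<phi> \<beta> (w \<beta> k) = of_bool (k = i \<beta>)"
    by metis
  obtain \<Phi> where \<Phi>: "linear \<Phi>"
    "\<And>x. \<forall>\<beta>\<in>A. x \<beta> \<in> tensor_space V \<beta> \<Longrightarrow> \<Phi> (\<Prod>\<beta>\<in>A. x \<beta>) = (\<Prod>\<beta>\<in>A. \<phi> \<beta> (x \<beta>))"
    using product_functional[OF A, of \<phi> V] \<phi>(1) by blast
  have "\<Phi> (\<Prod>\<beta>\<in>A. w \<beta> (j \<beta>)) = of_bool (j = i)" if j: "j \<in> multi_indices A r" for j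
  proof -
    have j': "j \<beta> \<in> {1..r \<beta>}" if "\<beta> \<in> A" for \<beta>
      using j that by (rule multi_indices_mem)
    have "\<forall>\<beta>\<in>A. w \<beta> (j \<beta>) \<in> tensor_space V \<beta>"
      using is_basis_mem[OF basis j'] U by blast
    then have "\<Phi> (\<Prod>\<beta>\<in>A. w \<beta> (j \<beta>)) = (\<Prod>\<beta>\<in>A. \<phi> \<beta> (w \<beta> (j \<beta>)))"
      by (rule \<Phi>(2))
    also have "\<dots> = (\<Prod>\<beta>\<in>A. of_bool (j \<beta> = i \<beta>))"
      using \<phi>(2) j' by (intro prod.cong) auto
    also have "\<dots> = of_bool (\<forall>\<beta>\<in>A. j \<beta> = i \<beta>)"
      using A(1) by (auto simp: prod_zero_iff)
    also have "(\<forall>\<beta>\<in>A. j \<beta> = i \<beta>) \<longleftrightarrow> j = i"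
      using i j unfolding multi_indices_def by (auto intro: PiE_ext)
    finally show ?thesis .
  qed
  then show thesis using that \<Phi>(1) by blast
qed

lemma coefficients_unique:
  assumes A: "finite A" "disjoint A"
    and basis: "\<And>\<beta>. \<beta> \<in> A \<Longrightarrow> is_basis (r \<beta>) (w \<beta>) (U \<beta>)"
    and U: "\<And>\<beta>. \<beta> \<in> A \<Longrightarrow> U \<beta> \<subseteq> tensor_space V \<beta>"
    and eq: "(\<Sum>i\<in>multi_indices A r. a i *\<^sub>R (\<Prod>\<beta>\<in>A. w \<beta> (i \<beta>))) =
      (\<Sum>i\<in>multi_indices A r. b i *\<^sub>R (\<Prod>\<beta>\<in>A. w \<beta> (i \<beta>)))"
    and i: "i \<in> multi_indices A r"
  shows "a i = b i"
proof -
  obtain \<Phi> :: "'a tensor \<Rightarrow> real" where \<Phi>: "linear \<Phi>"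
    "\<And>j. j \<in> multi_indices A r \<Longrightarrow> \<Phi> (\<Prod>\<beta>\<in>A. w \<beta> (j \<beta>)) = of_bool (j = i)"
    using coefficient_functional[OF A basis U i] by blast
  have "\<Phi> (\<Sum>j\<in>multi_indices A r. c j *\<^sub>R (\<Prod>\<beta>\<in>A. w \<beta> (j \<beta>))) = c i" for c
  proof -
    have "\<Phi> (\<Sum>j\<in>multi_indices A r. c j *\<^sub>R (\<Prod>\<beta>\<in>A. w \<beta> (j \<beta>))) =
        (\<Sum>j\<in>multi_indices A r. c j * \<Phi> (\<Prod>\<beta>\<in>A. w \<beta> (j \<beta>)))"
      by (simp add: linear_sum[OF \<Phi>(1)] linear_scale[OF \<Phi>(1)])
    also have "\<dots> = (\<Sum>j\<in>multi_indices A r. if j = i then c j else 0)"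
      by (rule sum.cong) (simp_all add: \<Phi>(2))
    finally show ?thesis
      using i finite_multi_indices[OF A(1)] by simp
  qed
  from this[of a] this[of b] show ?thesis using eq by simp
qed

text \<open>
  One step in the proof that \<open>\<Inter>\<^sub>\<beta> (U\<^sub>\<beta> \<otimes>\<^sub>a V\<^sub>\<mu>\<^sub>-\<^sub>\<beta>) = \<Otimes>\<^sub>\<beta> U\<^sub>\<beta>\<close>. The factors over \<open>A\<close> have been brought into
  their subspaces already; a projection onto \<open>U\<close> in the factor \<open>\<gamma>\<close> does the same for \<open>\<gamma>\<close>, and it
  leaves \<open>t\<close> fixed because \<open>t\<close> is already a sum of products whose \<open>\<gamma>\<close>-factor lies in \<open>U\<close>.
\<close>

lemma basis_products_step:
  assumes A: "A \<inter> B = {}" "disjoint (A \<union> B)" "\<gamma> \<in> B" "finite A"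
    and basis: "is_basis (r \<gamma>) (w \<gamma>) U" and U: "U \<subseteq> tensor_space V \<gamma>"
    and X: "span {\<Prod>\<beta>\<in>A. w \<beta> (i \<beta>) | i. i \<in> multi_indices A r} \<subseteq> tensor_space V (\<Union>A)"
    and t1: "t \<in> span {\<Prod>\<beta>\<in>A. w \<beta> (i \<beta>) | i. i \<in> multi_indices A r} \<otimes>\<^sub>a tensor_space V (\<Union>B)"
    and t2: "t \<in> U \<otimes>\<^sub>a tensor_space V (\<Union>(A \<union> B) - \<gamma>)"
  shows "t \<in> span {\<Prod>\<beta>\<in>insert \<gamma> A. w \<beta> (i \<beta>) | i. i \<in> multi_indices (insert \<gamma> A) r}
      \<otimes>\<^sub>a tensor_space V (\<Union>(B - {\<gamma>}))" (is "_ \<in> ?X' \<otimes>\<^sub>a _")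
proof -
  let ?G = "{\<Prod>\<beta>\<in>A. w \<beta> (i \<beta>) | i. i \<in> multi_indices A r}"
  have subU: "subspace U" using basis by (auto simp: is_basis_def)
  obtain P :: "'a tensor \<Rightarrow> 'a tensor" where P: "linear P" "\<And>x. P x \<in> U" "\<And>x. x \<in> U \<Longrightarrow> P x = x"
    using linear_exists_left_inverse_on[of "\<lambda>x. x" U] subU by (auto simp: linear_id[unfolded id_def] Pi_iff)
  have same: "a = b" if "x \<in> a" "x \<in> b" "a \<in> A \<union> B" "b \<in> A \<union> B" for x a b
    using A(2) that by (auto simp: disjoint_def)
  have disj: "\<gamma> \<inter> (\<Union>(A \<union> B) - \<gamma>) = {}" "\<gamma> \<inter> \<Union>(B - {\<gamma>}) = {}" "\<Union>A \<inter> \<Union>(B - {\<gamma>}) = {}"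
    using A(1,3) same by blast+
  have un: "\<Union>A \<union> \<Union>(B - {\<gamma>}) = \<Union>(A \<union> B) - \<gamma>" "\<gamma> \<union> \<Union>(B - {\<gamma>}) = \<Union>B"
    using A(1,3) same by blast+
  have bil: "bilinear (\<lambda>x y. P x * y)"
    by (auto simp: bilinear_def linear_iff linear_add[OF P(1)] linear_scale[OF P(1)] algebra_simps)
  \<comment> \<open>The projection \<open>P\<close> acting on the factor \<open>\<gamma>\<close> alone.\<close>
  let ?L = "tensor_lift \<gamma> (\<Union>(A \<union> B) - \<gamma>) (\<lambda>x y. P x * y)"
  note L = linear_tensor_lift[OF bil disj(1)] and L_mult = tensor_lift_mult[OF bil disj(1)]
  have Lt: "?L t = t"
    by (rule subspace_tensor_eq[OF L linear_id[unfolded id_def] _ t2])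
       (use U P(3) in \<open>auto simp: L_mult subset_iff simp del: Union_Un_distrib\<close>)
  have prod: "x * p \<in> ?X'" if "x \<in> U" "p \<in> span ?G" for x p
  proof (rule span_mult_span[of x "w \<gamma> ` {1..r \<gamma>}" p ?G])
    show "x \<in> span (w \<gamma> ` {1..r \<gamma>})" using that basis by (simp add: is_basis_def)
    fix a b assume "a \<in> w \<gamma> ` {1..r \<gamma>}" "b \<in> ?G"
    then obtain m i where m: "m \<in> {1..r \<gamma>}" "i \<in> multi_indices A r"
      "a = w \<gamma> m" "b = (\<Prod>\<beta>\<in>A. w \<beta> (i \<beta>))" by blast
    have "\<gamma> \<notin> A" using A(1,3) by blast
    then have "a * b = (\<Prod>\<beta>\<in>insert \<gamma> A. w \<beta> ((i(\<gamma> := m)) \<beta>))"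
      using A(4) by (auto simp: m(3,4) intro!: arg_cong2[where f="(*)"] prod.cong)
    moreover have "i(\<gamma> := m) \<in> multi_indices (insert \<gamma> A) r"
      unfolding multi_indices_insert using m(1,2) by force
    ultimately show "a * b \<in> ?X'" by (intro span_base) blast
  qed (use that in simp_all)
  have "?L t \<in> ?X' \<otimes>\<^sub>a tensor_space V (\<Union>(B - {\<gamma>}))"
  proof (rule subspace_tensor_map[OF L subspace_subspace_tensor _ t1])
    fix p z assume p: "p \<in> span ?G" and z: "z \<in> tensor_space V (\<Union>B)"
    have z': "z \<in> tensor_space V \<gamma> \<otimes>\<^sub>a tensor_space V (\<Union>(B - {\<gamma>}))"
      using z tensor_space_union[OF disj(2), of V] un(2) by simp
    have lin: "linear (\<lambda>z. ?L (p * z))"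
      using linear_compose[OF linear_tensor_mult(1) L] by (simp add: o_def)
    show "?L (p * z) \<in> ?X' \<otimes>\<^sub>a tensor_space V (\<Union>(B - {\<gamma>}))"
    proof (rule subspace_tensor_map[OF lin subspace_subspace_tensor _ z'])
      fix g y assume g: "g \<in> tensor_space V \<gamma>" and y: "y \<in> tensor_space V (\<Union>(B - {\<gamma>}))"
      have "p * y \<in> tensor_space V (\<Union>(A \<union> B) - \<gamma>)"
        using tensor_space_mult[OF disj(3), of p V y] p X y un(1) by auto
      then have "?L (g * (p * y)) = (P g * p) * y"
        using L_mult[OF g] by (simp only: mult.assoc)
      then have "?L (p * (g * y)) = (P g * p) * y"
        by (simp add: mult.left_commute)
      then show "?L (p * (g * y)) \<in> ?X' \<otimes>\<^sub>a tensor_space V (\<Union>(B - {\<gamma>}))"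
        using prod[OF P(2) p] y by (simp add: subspace_tensor_base)
    qed
  qed
  then show ?thesis using Lt by simp
qed

lemma span_finite_family:
  fixes g :: "'i \<Rightarrow> 'b::real_vector"
  assumes "finite I" "t \<in> span {g i | i. i \<in> I}"
  obtains c where "t = (\<Sum>i\<in>I. c i *\<^sub>R g i)"
proof -
  have "\<exists>c. t = (\<Sum>i\<in>I. c i *\<^sub>R g i)"
    using assms(2)
  proof (induction rule: span_induct_alt)
    case base
    show ?case by (intro exI[of _ "\<lambda>_. 0"]) simp
  next
    case (step a x y)
    then obtain j c where j: "j \<in> I" "x = g j" "y = (\<Sum>i\<in>I. c i *\<^sub>R g i)" by blast
    have "a *\<^sub>R x = (\<Sum>i\<in>I. (if i = j then a else 0) *\<^sub>R g i)"
      using j(1,2) assms(1) by (simp add: if_distrib[where f="\<lambda>c. c *\<^sub>R _"] cong: if_cong)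
    then have "a *\<^sub>R x + y = (\<Sum>i\<in>I. ((if i = j then a else 0) + c i) *\<^sub>R g i)"
      using j(3) by (simp add: sum.distrib scaleR_left_distrib)
    then show ?case by (rule exI[of _ "\<lambda>i. (if i = j then a else 0) + c i"])
  qed
  then show thesis using that by blast
qed

text \<open>
  The factors are projected one after another, starting from \<open>t \<in> V\<^sub>\<emptyset> \<otimes>\<^sub>a V\<^sub>\<Union>\<^sub>A\<close> and ending in the span
  of the products of basis vectors.
\<close>

lemma basis_products_expansion:
  assumes A: "finite A" "disjoint A"
    and basis: "\<And>\<beta>. \<beta> \<in> A \<Longrightarrow> is_basis (r \<beta>) (w \<beta>) (U \<beta>)"
    and U: "\<And>\<beta>. \<beta> \<in> A \<Longrightarrow> U \<beta> \<subseteq> tensor_space V \<beta>"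
    and t: "t \<in> tensor_space V (\<Union>A)"
      "\<And>\<beta>. \<beta> \<in> A \<Longrightarrow> t \<in> U \<beta> \<otimes>\<^sub>a tensor_space V (\<Union>A - \<beta>)"
  obtains c where "t = (\<Sum>i\<in>multi_indices A r. c i *\<^sub>R (\<Prod>\<beta>\<in>A. w \<beta> (i \<beta>)))"
proof -
  let ?X = "\<lambda>B. span {\<Prod>\<beta>\<in>B. w \<beta> (i \<beta>) | i. i \<in> multi_indices B r}"
  have X: "?X B \<subseteq> tensor_space V (\<Union>B)" if "B \<subseteq> A" for B
  proof (rule span_minimal[OF _ subspace_tensor_space], clarify)
    fix i assume "i \<in> multi_indices B r"
    then have "w \<beta> (i \<beta>) \<in> tensor_space V \<beta>" if "\<beta> \<in> B" for \<beta>
      using is_basis_mem[OF basis, of \<beta> "i \<beta>"] U[of \<beta>] that multi_indices_mem[of i B r \<beta>] \<open>B \<subseteq> A\<close>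
      by blast
    then show "(\<Prod>\<beta>\<in>B. w \<beta> (i \<beta>)) \<in> tensor_space V (\<Union>B)"
      by (intro prod_in_tensor_space)
         (use that A in \<open>auto intro: finite_subset pairwise_subset\<close>)
  qed
  have "t \<in> ?X B \<otimes>\<^sub>a tensor_space V (\<Union>(A - B))" if "B \<subseteq> A" for B
    using finite_subset[OF that A(1)] that
  proof (induction B rule: finite_induct)
    case empty
    have "1 \<in> ?X {}" by (intro span_base) (auto simp: multi_indices_def)
    then show ?case using subspace_tensor_base[of 1 "?X {}" t] t(1) by simp
  next
    case (insert \<gamma> B)
    have BA: "B \<union> (A - B) = A" "A - insert \<gamma> B = A - B - {\<gamma>}" using insert.prems by auto
    have \<gamma>: "\<gamma> \<in> A" and B: "B \<subseteq> A" using insert.prems by auto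
    show ?case
      unfolding BA(2)
    proof (rule basis_products_step[OF _ _ _ insert.hyps(1) basis[OF \<gamma>] U[OF \<gamma>] X[OF B] insert.IH[OF B]],
        unfold BA(1))
      show "\<gamma> \<in> A - B" using \<gamma> insert.hyps(2) by blast
    qed (use A(2) t(2)[OF \<gamma>] in auto)
  qed
  from this[of A] have "t \<in> ?X A \<otimes>\<^sub>a span {1}"
    by (simp add: tensor_space_empty)
  moreover have "?X A \<otimes>\<^sub>a span {1} \<subseteq> ?X A"
    by (rule subspace_tensor_subset) (auto simp: span_singleton intro: span_scale)
  ultimately have "t \<in> ?X A" by blast
  then show thesis
    by (rule span_finite_family[OF finite_multi_indices[OF A(1)]]) (rule that)
qed

section \<open>Minimal subspaces along a partition\<close>

text \<open>
  Minimal subspaces are nested: \<open>t\<close> is a contraction of \<open>v\<close> over factors outside \<open>\<mu>\<close>, and such a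
  contraction does not affect the factor \<open>\<alpha>\<close>, which lies in the minimal subspace of \<open>v\<close> at \<open>\<alpha>\<close>.
\<close>

lemma Umin_nested:
  assumes "\<alpha> \<subseteq> \<mu>" "\<mu> \<subseteq> D" and v: "v \<in> tensor_space V D" and t: "t \<in> Umin V D \<mu> v"
  shows "t \<in> Umin V D \<alpha> v \<otimes>\<^sub>a tensor_space V (\<mu> - \<alpha>)"
proof -
  have \<alpha>: "\<alpha> \<subseteq> D" using assms by blast
  obtain \<phi> where \<phi>: "linear \<phi>" "t = contraction \<mu> (D - \<mu>) \<phi> v"
    using t unfolding Umin_eq_contractions[OF assms(2) v] by blast
  have disj: "\<mu> \<inter> (D - \<mu>) = {}" "(\<mu> - \<alpha>) \<inter> (D - \<mu>) = {}" "\<alpha> \<inter> (\<mu> - \<alpha>) = {}" by auto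
  have un: "(\<mu> - \<alpha>) \<union> (D - \<mu>) = D - \<alpha>" "\<alpha> \<union> (\<mu> - \<alpha>) = \<mu>" using assms(1,2) by auto
  note L = linear_contraction[OF \<phi>(1) disj(1)]
  show ?thesis
    unfolding \<phi>(2)
  proof (rule subspace_tensor_map[OF L subspace_subspace_tensor _ Umin_mem[OF \<alpha> v]])
    fix u z assume u: "u \<in> Umin V D \<alpha> v" and z: "z \<in> tensor_space V (D - \<alpha>)"
    have lin: "linear (\<lambda>z. contraction \<mu> (D - \<mu>) \<phi> (u * z))"
      using linear_compose[OF linear_tensor_mult(1) L] by (simp add: o_def)
    have z': "z \<in> tensor_space V (\<mu> - \<alpha>) \<otimes>\<^sub>a tensor_space V (D - \<mu>)"
      using z tensor_space_union[OF disj(2), of V] un(1) by simp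
    show "contraction \<mu> (D - \<mu>) \<phi> (u * z) \<in> Umin V D \<alpha> v \<otimes>\<^sub>a tensor_space V (\<mu> - \<alpha>)"
    proof (rule subspace_tensor_map[OF lin subspace_subspace_tensor _ z'])
      fix a b assume a: "a \<in> tensor_space V (\<mu> - \<alpha>)" and b: "b \<in> tensor_space V (D - \<mu>)"
      have "u * a \<in> tensor_space V \<mu>"
        using tensor_space_mult[OF disj(3), of u V a] Umin_subset[OF \<alpha> v] u a un(2) by auto
      then have "contraction \<mu> (D - \<mu>) \<phi> (u * (a * b)) = \<phi> b *\<^sub>R (u * a)"
        using contraction_mult[OF \<phi>(1) disj(1) _ b] by (simp flip: mult.assoc)
      then show "contraction \<mu> (D - \<mu>) \<phi> (u * (a * b)) \<in> Umin V D \<alpha> v \<otimes>\<^sub>a tensor_space V (\<mu> - \<alpha>)"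
        using u a by (simp add: subspace_scale[OF subspace_subspace_tensor] subspace_tensor_base)
    qed
  qed
qed

text \<open>
  Sorted by the index of \<open>\<beta>\<close>, the expansion reads \<open>v = (\<Sum>m. w \<beta> m * y m)\<close>. Every basis vector \<open>w \<beta> m\<close> of
  the minimal subspace is a contraction of \<open>v\<close>, that is, \<open>w \<beta> m = (\<Sum>k. \<phi> (y k) *\<^sub>R w \<beta> k)\<close> for some
  functional \<open>\<phi>\<close>. Comparing coefficients shows that the functionals obtained in this way are
  biorthogonal to the \<open>y k\<close>, which are the combinations formed with the rows of the matricisation.
\<close>

lemma root_coefficients_full_rank:
  assumes A: "finite A" "disjoint A" "\<Union>A = D" "\<beta> \<in> A"
    and v: "v \<in> tensor_space V D"
    and basis: "\<And>\<gamma>. \<gamma> \<in> A \<Longrightarrow> is_basis (r \<gamma>) (w \<gamma>) (Umin V D \<gamma> v)"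
    and C: "v = (\<Sum>i\<in>multi_indices A r. C i *\<^sub>R (\<Prod>\<gamma>\<in>A. w \<gamma> (i \<gamma>)))"
  shows "matricisation_rank \<beta> A r C = r \<beta>"
proof -
  define B where "B = A - {\<beta>}"
  have B: "A = insert \<beta> B" "\<beta> \<notin> B" "finite B" "disjoint B" "\<Union>B = D - \<beta>"
    using A by (auto simp: B_def disjoint_def intro: pairwise_subset)
  define y where "y m = (\<Sum>i\<in>multi_indices B r. C (i(\<beta> := m)) *\<^sub>R (\<Prod>\<gamma>\<in>B. w \<gamma> (i \<gamma>)))" for m
  have \<beta>: "\<beta> \<subseteq> D" "\<beta> \<inter> (D - \<beta>) = {}" using A by auto
  have D: "\<gamma> \<subseteq> D" if "\<gamma> \<in> A" for \<gamma> using A(3) that by blast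
  have y: "y m \<in> tensor_space V (D - \<beta>)" for m
    unfolding y_def
  proof (intro subspace_sum subspace_scale subspace_tensor_space)
    fix i assume i: "i \<in> multi_indices B r"
    have "w \<gamma> (i \<gamma>) \<in> tensor_space V \<gamma>" if "\<gamma> \<in> B" for \<gamma>
      using is_basis_mem[OF basis, of \<gamma> "i \<gamma>"] Umin_subset[OF D v, of \<gamma>] that B(1)
        multi_indices_mem[OF i that] by blast
    then show "(\<Prod>\<gamma>\<in>B. w \<gamma> (i \<gamma>)) \<in> tensor_space V (D - \<beta>)"
      using prod_in_tensor_space[OF B(3,4), of "\<lambda>\<gamma>. w \<gamma> (i \<gamma>)" V] B(5) by simp
  qed
  have prod: "(\<Prod>\<gamma>\<in>A. w \<gamma> ((i(\<beta> := m)) \<gamma>)) = w \<beta> m * (\<Prod>\<gamma>\<in>B. w \<gamma> (i \<gamma>))" for i m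
    using B(2,3) by (auto simp: B(1) intro!: arg_cong2[where f="(*)"] prod.cong)
  have "v = (\<Sum>m\<in>{1..r \<beta>}. \<Sum>i\<in>multi_indices B r. C (i(\<beta> := m)) *\<^sub>R (w \<beta> m * (\<Prod>\<gamma>\<in>B. w \<gamma> (i \<gamma>))))"
    by (subst C, subst (1) B(1), subst sum_multi_indices_insert[OF B(2)]) (simp only: prod)
  then have vy: "v = (\<Sum>m\<in>{1..r \<beta>}. w \<beta> m * y m)"
    by (simp add: y_def sum_distrib_left)
  have w: "w \<beta> m \<in> Umin V D \<beta> v" "w \<beta> m \<in> tensor_space V \<beta>" if "m \<in> {1..r \<beta>}" for m
    using is_basis_mem[OF basis[OF A(4)] that] Umin_subset[OF \<beta>(1) v] by auto
  have "\<exists>\<phi> :: 'a tensor \<Rightarrow> real. linear \<phi> \<and> (\<forall>k\<in>{1..r \<beta>}. \<phi> (y k) = of_bool (k = m))"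
    if m: "m \<in> {1..r \<beta>}" for m
  proof -
    obtain \<phi> where \<phi>: "linear \<phi>" "w \<beta> m = contraction \<beta> (D - \<beta>) \<phi> v"
      using w(1)[OF m] unfolding Umin_eq_contractions[OF \<beta>(1) v] by blast
    have "contraction \<beta> (D - \<beta>) \<phi> v = (\<Sum>k\<in>{1..r \<beta>}. contraction \<beta> (D - \<beta>) \<phi> (w \<beta> k * y k))"
      by (subst vy) (rule linear_sum[OF linear_contraction[OF \<phi>(1) \<beta>(2)]])
    also have "\<dots> = (\<Sum>k\<in>{1..r \<beta>}. \<phi> (y k) *\<^sub>R w \<beta> k)"
      by (rule sum.cong[OF refl]) (rule contraction_mult[OF \<phi>(1) \<beta>(2) w(2) y])
    finally have eq: "w \<beta> m = (\<Sum>k\<in>{1..r \<beta>}. \<phi> (y k) *\<^sub>R w \<beta> k)" using \<phi>(2) by simp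
    have "\<phi> (y k) = of_bool (k = m)" if k: "k \<in> {1..r \<beta>}" for k
    proof -
      obtain \<psi> :: "'a tensor \<Rightarrow> real" where \<psi>: "linear \<psi>"
        "\<And>l. l \<in> {1..r \<beta>} \<Longrightarrow> \<psi> (w \<beta> l) = of_bool (l = k)"
        using is_basis_dual[OF basis[OF A(4)] k] by blast
      have "of_bool (m = k) = \<psi> (w \<beta> m)" using \<psi>(2)[OF m] by simp
      also have "\<dots> = (\<Sum>l\<in>{1..r \<beta>}. \<phi> (y l) * \<psi> (w \<beta> l))"
        by (subst eq) (simp add: linear_sum[OF \<psi>(1)] linear_scale[OF \<psi>(1)])
      also have "\<dots> = (\<Sum>l\<in>{1..r \<beta>}. if l = k then \<phi> (y l) else 0)"
        by (rule sum.cong) (simp_all add: \<psi>(2))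
      also have "\<dots> = \<phi> (y k)" using k by simp
      finally show ?thesis by (simp add: eq_commute)
    qed
    then show ?thesis using \<phi>(1) by blast
  qed
  then obtain \<phi> :: "nat \<Rightarrow> 'a tensor \<Rightarrow> real" where \<phi>: "\<And>m. m \<in> {1..r \<beta>} \<Longrightarrow> linear (\<phi> m)"
    "\<And>m k. m \<in> {1..r \<beta>} \<Longrightarrow> k \<in> {1..r \<beta>} \<Longrightarrow> \<phi> m (y k) = of_bool (k = m)"
    by metis
  show ?thesis
    unfolding matricisation_rank_def B_def[symmetric]
    by (rule matrix_rank_full[where \<phi>=\<phi> and h="\<lambda>i. \<Prod>\<gamma>\<in>B. w \<gamma> (i \<gamma>)"])
       (simp_all add: \<phi> matricise_def flip: y_def)
qed

lemma Umin_basis_exists: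
  assumes "\<alpha> \<subseteq> D" "v \<in> tensor_space V D"
  shows "\<exists>b. is_basis (dim (Umin V D \<alpha> v)) b (Umin V D \<alpha> v)"
proof -
  obtain F where F: "finite F" "Umin V D \<alpha> v = span F"
    using Umin_finite_span[OF assms] by blast
  show ?thesis by (rule is_basis_exists[OF F]) (rule exI)
qed

text \<open>
  A tensor belongs to the product of its minimal subspace with the complementary factor, hence it
  vanishes as soon as that subspace does. This is what ties the rank at the root to the ranks below.
\<close>

lemma dim_Umin_eq_0_iff:
  assumes \<alpha>: "\<alpha> \<subseteq> D" and v: "v \<in> tensor_space V D"
  shows "dim (Umin V D \<alpha> v) = 0 \<longleftrightarrow> v = 0"
proof
  assume "dim (Umin V D \<alpha> v) = 0"
  then obtain b where "is_basis 0 b (Umin V D \<alpha> v)"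
    using Umin_basis_exists[OF \<alpha> v] by metis
  then have "Umin V D \<alpha> v = {0}" by (simp add: is_basis_def)
  then have "v \<in> {0} \<otimes>\<^sub>a tensor_space V (D - \<alpha>)" using Umin_mem[OF \<alpha> v] by simp
  moreover have "{0} \<otimes>\<^sub>a tensor_space V (D - \<alpha>) \<subseteq> {0}"
    by (rule subspace_tensor_subset) (simp_all add: subspace_single_0)
  ultimately show "v = 0" by blast
next
  assume "v = 0"
  then have "Umin V D \<alpha> v \<subseteq> {0}"
    unfolding Umin_eq_contractions[OF \<alpha> v] by (auto simp: linear_0[OF linear_contraction])
  then have "Umin V D \<alpha> v = span {}"
    using subspace_0[OF subspace_Umin[OF \<alpha> v]] by auto
  then show "dim (Umin V D \<alpha> v) = 0"
    using dim_span_eq_card_independent[of "{} :: 'a tensor set"] by (simp add: independent_empty)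
qed

lemma dim_Umin_root: "dim (Umin V D D v) = (if v = 0 then 0 else 1)"
proof (cases "v = 0")
  case True
  then have "Umin V D D v = span {}" by (simp add: Umin_def)
  then show ?thesis
    using True dim_span_eq_card_independent[of "{} :: 'a tensor set"] by (simp add: independent_empty)
next
  case False
  then show ?thesis
    using dim_span_eq_card_independent[of "{v}"] by (simp add: Umin_def)
qed

section \<open>Dimension partition trees\<close>

lemma inner_vertex:
  assumes "dim_partition_tree D T S" "finite D" "\<mu> \<in> T" "S \<mu> \<noteq> {}"
  shows "\<mu> \<subseteq> D" "\<Union>(S \<mu>) = \<mu>" "disjoint (S \<mu>)" "finite (S \<mu>)" "\<mu> \<notin> S \<mu>" "S \<mu> \<subseteq> T - {D}"
proof -
  have T: "\<mu> \<noteq> {}" "\<mu> \<subseteq> D" "2 \<le> card \<mu> \<longrightarrow> 2 \<le> card (S \<mu>) \<and> partition_on \<mu> (S \<mu>)" "card \<mu> \<noteq> 1"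
    using assms unfolding dim_partition_tree_def by blast+
  have "finite \<mu>" using T(2) assms(2) by (rule finite_subset)
  then have "card \<mu> \<noteq> 0" using T(1) by simp
  then have S: "2 \<le> card (S \<mu>)" "partition_on \<mu> (S \<mu>)"
    using T(3,4) by linarith+
  show "\<mu> \<subseteq> D" by (fact T(2))
  show un: "\<Union>(S \<mu>) = \<mu>" and disj: "disjoint (S \<mu>)"
    using S(2) by (auto simp: partition_on_def)
  show fin: "finite (S \<mu>)"
    using finite_elements[OF \<open>finite \<mu>\<close> S(2)] .
  show "\<mu> \<notin> S \<mu>"
  proof
    assume \<mu>: "\<mu> \<in> S \<mu>"
    have "S \<mu> \<subseteq> {\<mu>}"
    proof
      fix \<beta> assume \<beta>: "\<beta> \<in> S \<mu>"
      then have "\<beta> \<subseteq> \<mu>" "\<beta> \<noteq> {}" using S(2) un by (auto simp: partition_on_def)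
      then have "\<beta> \<inter> \<mu> \<noteq> {}" by blast
      then show "\<beta> \<in> {\<mu>}" using disjointD[OF disj \<beta> \<mu>] by blast
    qed
    then show False using S(1) card_mono[of "{\<mu>}" "S \<mu>"] by simp
  qed
  show "S \<mu> \<subseteq> T - {D}"
    using assms(1,3) unfolding dim_partition_tree_def rooted_tree_def by blast
qed

section \<open>Transfer arrays\<close>

lemma sons_expansion:
  assumes tree: "dim_partition_tree D T S" "finite D" "\<mu> \<in> T" "S \<mu> \<noteq> {}"
    and v: "v \<in> tensor_space V D" and t: "t \<in> Umin V D \<mu> v"
    and basis: "\<And>\<beta>. \<beta> \<in> S \<mu> \<Longrightarrow> is_basis (r \<beta>) (w \<beta>) (Umin V D \<beta> v)"
  shows "\<exists>c. t = (\<Sum>i\<in>multi_indices (S \<mu>) r. c i *\<^sub>R (\<Prod>\<beta>\<in>S \<mu>. w \<beta> (i \<beta>)))"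
proof -
  note \<mu> = inner_vertex[OF tree]
  have sub: "\<beta> \<subseteq> \<mu>" "\<beta> \<subseteq> D" if "\<beta> \<in> S \<mu>" for \<beta> using \<mu>(1,2) that by auto
  have U: "Umin V D \<beta> v \<subseteq> tensor_space V \<beta>" if "\<beta> \<in> S \<mu>" for \<beta>
    using Umin_subset[OF sub(2)[OF that] v] .
  have t1: "t \<in> tensor_space V (\<Union>(S \<mu>))"
    using Umin_subset[OF \<mu>(1) v] t unfolding \<mu>(2) by blast
  have t2: "t \<in> Umin V D \<beta> v \<otimes>\<^sub>a tensor_space V (\<Union>(S \<mu>) - \<beta>)" if "\<beta> \<in> S \<mu>" for \<beta>
    using Umin_nested[OF sub(1)[OF that] \<mu>(1) v t] unfolding \<mu>(2) .
  show ?thesis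
    by (rule basis_products_expansion[OF \<mu>(4,3), of r w "\<lambda>\<beta>. Umin V D \<beta> v" V t])
       (fact basis U t1 t2 | erule exI)+
qed

text \<open>
  Expand \<open>v\<close>, which spans its own minimal subspace at the root, in the products of the bases at the
  sons. The array is cut down to an extensional function so that its entries determine it.
\<close>

lemma root_array_exists_unique:
  assumes tree: "dim_partition_tree D T S" "finite D" "S D \<noteq> {}"
    and v: "v \<in> tensor_space V D"
    and basis: "\<And>\<beta>. \<beta> \<in> S D \<Longrightarrow> is_basis (r \<beta>) (w \<beta>) (Umin V D \<beta> v)"
  shows "\<exists>!C. C \<in> full_rank_arrays (S D) r \<and>
    v = (\<Sum>i\<in>multi_indices (S D) r. C i *\<^sub>R (\<Prod>\<alpha>\<in>S D. w \<alpha> (i \<alpha>)))"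
proof -
  have "D \<in> T" using tree(1) by (simp add: dim_partition_tree_def rooted_tree_def)
  note root = tree(1,2) \<open>D \<in> T\<close> tree(3) and D = inner_vertex[OF tree(1,2) \<open>D \<in> T\<close> tree(3)]
  have U: "Umin V D \<beta> v \<subseteq> tensor_space V \<beta>" if "\<beta> \<in> S D" for \<beta>
    using Umin_subset[of \<beta> D v V] D(2) that v by blast
  have "v \<in> Umin V D D v" by (simp add: Umin_def span_base)
  then obtain c where c: "v = (\<Sum>i\<in>multi_indices (S D) r. c i *\<^sub>R (\<Prod>\<beta>\<in>S D. w \<beta> (i \<beta>)))"
    using sons_expansion[OF root v _ basis] by blast
  let ?C = "restrict c (multi_indices (S D) r)"
  show ?thesis
  proof (rule ex1I[of _ ?C], intro conjI)
    show *: "v = (\<Sum>i\<in>multi_indices (S D) r. ?C i *\<^sub>R (\<Prod>\<beta>\<in>S D. w \<beta> (i \<beta>)))"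
      by (subst c) (rule sum.cong, simp_all)
    have "matricisation_rank \<beta> (S D) r ?C = r \<beta>" if "\<beta> \<in> S D" for \<beta>
      by (rule root_coefficients_full_rank[OF D(4,3,2) that v basis *])
    then show "?C \<in> full_rank_arrays (S D) r"
      by (simp add: full_rank_arrays_def arrays_def)
  next
    fix C assume C: "C \<in> full_rank_arrays (S D) r \<and>
      v = (\<Sum>i\<in>multi_indices (S D) r. C i *\<^sub>R (\<Prod>\<alpha>\<in>S D. w \<alpha> (i \<alpha>)))"
    then have eq: "(\<Sum>i\<in>multi_indices (S D) r. C i *\<^sub>R (\<Prod>\<alpha>\<in>S D. w \<alpha> (i \<alpha>))) =
        (\<Sum>i\<in>multi_indices (S D) r. c i *\<^sub>R (\<Prod>\<beta>\<in>S D. w \<beta> (i \<beta>)))"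
      using c by simp
    have "C \<in> extensional (multi_indices (S D) r)"
      using C by (auto simp: full_rank_arrays_def arrays_def PiE_def)
    then show "C = ?C"
      by (rule extensionalityI[OF _ restrict_extensional])
         (simp add: coefficients_unique[OF D(4,3) basis U eq])
  qed
qed

text \<open>
  The expansions of the basis vectors \<open>w \<mu> m\<close> are collected into one array. Its rows have rank \<open>r \<mu>\<close>
  because the functionals dual to the \<open>w \<mu> m\<close> are biorthogonal to the combinations that they form.
\<close>

lemma inner_array_exists_unique:
  assumes tree: "dim_partition_tree D T S" "finite D" "\<mu> \<in> T" "S \<mu> \<noteq> {}"
    and v: "v \<in> tensor_space V D"
    and basis: "\<And>\<beta>. \<beta> \<in> S \<mu> \<Longrightarrow> is_basis (r \<beta>) (w \<beta>) (Umin V D \<beta> v)"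
    and basis\<mu>: "is_basis (r \<mu>) (w \<mu>) (Umin V D \<mu> v)"
  shows "\<exists>!C. C \<in> arrays (insert \<mu> (S \<mu>)) r \<and>
    matricisation_rank \<mu> (insert \<mu> (S \<mu>)) r C = r \<mu> \<and>
    (\<forall>m\<in>{1..r \<mu>}. w \<mu> m =
      (\<Sum>i\<in>multi_indices (S \<mu>) r. C (i(\<mu> := m)) *\<^sub>R (\<Prod>\<beta>\<in>S \<mu>. w \<beta> (i \<beta>))))"
proof -
  note \<mu> = inner_vertex[OF tree]
  let ?I = "multi_indices (insert \<mu> (S \<mu>)) r"
  have U: "Umin V D \<beta> v \<subseteq> tensor_space V \<beta>" if "\<beta> \<in> S \<mu>" for \<beta>
    using Umin_subset[of \<beta> D v V] \<mu>(1,2) that v by blast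
  have "\<exists>c. w \<mu> m = (\<Sum>i\<in>multi_indices (S \<mu>) r. c i *\<^sub>R (\<Prod>\<beta>\<in>S \<mu>. w \<beta> (i \<beta>)))"
    if "m \<in> {1..r \<mu>}" for m
    using sons_expansion[OF tree v is_basis_mem[OF basis\<mu> that] basis] .
  then obtain c where c: "\<And>m. m \<in> {1..r \<mu>} \<Longrightarrow>
      w \<mu> m = (\<Sum>i\<in>multi_indices (S \<mu>) r. c m i *\<^sub>R (\<Prod>\<beta>\<in>S \<mu>. w \<beta> (i \<beta>)))"
    by metis
  \<comment> \<open>A multi-index over the sons takes the default value at \<open>\<mu>\<close>, so resetting \<open>\<mu>\<close> to it recovers the column index.\<close>
  have upd: "i(\<mu> := m, \<mu> := undefined) = i" if "i \<in> multi_indices (S \<mu>) r" for i m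
    using that \<mu>(5) PiE_arb[of i "S \<mu>" _ \<mu>] by (auto simp: multi_indices_def)
  have upd_mem: "i(\<mu> := m) \<in> ?I" if "m \<in> {1..r \<mu>}" "i \<in> multi_indices (S \<mu>) r" for i m
    unfolding multi_indices_insert using that by force
  define C where "C = restrict (\<lambda>k. c (k \<mu>) (k(\<mu> := undefined))) ?I"
  have C: "C (i(\<mu> := m)) = c m i" if "m \<in> {1..r \<mu>}" "i \<in> multi_indices (S \<mu>) r" for m i
    using upd_mem[OF that] upd[OF that(2), of m] by (simp add: C_def)
  have w: "w \<mu> m = (\<Sum>i\<in>multi_indices (S \<mu>) r. C (i(\<mu> := m)) *\<^sub>R (\<Prod>\<beta>\<in>S \<mu>. w \<beta> (i \<beta>)))"
    if "m \<in> {1..r \<mu>}" for m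
    unfolding c[OF that] by (rule sum.cong) (simp_all add: C[OF that])
  have "\<exists>\<phi> :: 'a tensor \<Rightarrow> real. linear \<phi> \<and> (\<forall>k\<in>{1..r \<mu>}. \<phi> (w \<mu> k) = of_bool (k = m))"
    if "m \<in> {1..r \<mu>}" for m
    using is_basis_dual[OF basis\<mu> that] by metis
  then obtain \<phi> :: "nat \<Rightarrow> 'a tensor \<Rightarrow> real" where \<phi>: "\<And>m. m \<in> {1..r \<mu>} \<Longrightarrow> linear (\<phi> m)"
    "\<And>m k. m \<in> {1..r \<mu>} \<Longrightarrow> k \<in> {1..r \<mu>} \<Longrightarrow> \<phi> m (w \<mu> k) = of_bool (k = m)"
    by metis
  have rank: "matricisation_rank \<mu> (insert \<mu> (S \<mu>)) r C = r \<mu>"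
    unfolding matricisation_rank_def Diff_insert_absorb[OF \<mu>(5)]
    by (rule matrix_rank_full[where \<phi>=\<phi> and h="\<lambda>i. \<Prod>\<beta>\<in>S \<mu>. w \<beta> (i \<beta>)"])
       (simp_all add: \<phi> matricise_def flip: w)
  show ?thesis
  proof (rule ex1I[of _ C], intro conjI ballI)
    show "C \<in> arrays (insert \<mu> (S \<mu>)) r" by (simp add: C_def arrays_def)
  next
    fix C' assume *: "C' \<in> arrays (insert \<mu> (S \<mu>)) r \<and>
      matricisation_rank \<mu> (insert \<mu> (S \<mu>)) r C' = r \<mu> \<and>
      (\<forall>m\<in>{1..r \<mu>}. w \<mu> m =
        (\<Sum>i\<in>multi_indices (S \<mu>) r. C' (i(\<mu> := m)) *\<^sub>R (\<Prod>\<beta>\<in>S \<mu>. w \<beta> (i \<beta>))))"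
    have "C' \<in> extensional ?I" "C \<in> extensional ?I"
      using * by (auto simp: arrays_def PiE_def C_def)
    then show "C' = C"
    proof (rule extensionalityI)
      fix k assume "k \<in> ?I"
      then obtain m i where k: "m \<in> {1..r \<mu>}" "i \<in> multi_indices (S \<mu>) r" "k = i(\<mu> := m)"
        unfolding multi_indices_insert by auto
      have "(\<Sum>i\<in>multi_indices (S \<mu>) r. C' (i(\<mu> := m)) *\<^sub>R (\<Prod>\<beta>\<in>S \<mu>. w \<beta> (i \<beta>))) =
          (\<Sum>i\<in>multi_indices (S \<mu>) r. C (i(\<mu> := m)) *\<^sub>R (\<Prod>\<beta>\<in>S \<mu>. w \<beta> (i \<beta>)))"
        using * k(1) by (subst w[OF k(1), symmetric]) simp
      from coefficients_unique[OF \<mu>(4,3) basis U this k(2)] show "C' k = C k"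
        by (simp add: k(3))
    qed
  qed (fact rank w)+
qed

text \<open>
  The given leaf bases are completed by arbitrary bases of the minimal subspaces at the inner
  vertices; their sizes are the prescribed ranks.
\<close>

lemma tree_representation_of_fixed_rank:
  assumes tree: "dim_partition_tree D T S" "finite D" "S D \<noteq> {}"
    and v: "v \<in> fixed_rank_tensors r V D T" and u: "leaf_bases V D T S r v u"
  shows "tree_representation V D T S r v u"
proof -
  have vD: "v \<in> tensor_space V D" and dim: "\<And>\<alpha>. \<alpha> \<in> T \<Longrightarrow> dim (Umin V D \<alpha> v) = r \<alpha>"
    using v by (auto simp: fixed_rank_tensors_def)
  have T: "\<alpha> \<subseteq> D" if "\<alpha> \<in> T" for \<alpha> using tree(1) that by (auto simp: dim_partition_tree_def)
  have "D \<in> T" using tree(1) by (simp add: dim_partition_tree_def rooted_tree_def)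
  have "\<exists>b. is_basis (r \<alpha>) b (Umin V D \<alpha> v)" if "\<alpha> \<in> T" for \<alpha>
    using Umin_basis_exists[OF T[OF that] vD] dim[OF that] by metis
  then obtain b where b: "\<And>\<alpha>. \<alpha> \<in> T \<Longrightarrow> is_basis (r \<alpha>) (b \<alpha>) (Umin V D \<alpha> v)" by metis
  define w where "w \<alpha> = (if \<alpha> \<in> leaves T S then u \<alpha> else b \<alpha>)" for \<alpha>
  have w: "is_basis (r \<alpha>) (w \<alpha>) (Umin V D \<alpha> v)" if "\<alpha> \<in> T" for \<alpha>
    using b[OF that] u by (simp add: w_def leaf_bases_def)
  have sons: "is_basis (r \<beta>) (w \<beta>) (Umin V D \<beta> v)" if "\<mu> \<in> T" "\<beta> \<in> S \<mu>" for \<mu> \<beta>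
    using w inner_vertex(6)[OF tree(1,2), of \<mu>] that by blast
  show ?thesis
    unfolding tree_representation_def
  proof (rule exI[of _ w], intro conjI ballI impI)
    show "w k i = u k i" if "k \<in> leaves T S" for k i using that by (simp add: w_def)
    show "\<exists>!C. C \<in> full_rank_arrays (S D) r \<and>
        v = (\<Sum>i\<in>multi_indices (S D) r. C i *\<^sub>R (\<Prod>\<alpha>\<in>S D. w \<alpha> (i \<alpha>)))"
      by (rule root_array_exists_unique[OF tree vD sons[OF \<open>D \<in> T\<close>]])
    fix \<mu> assume \<mu>: "\<mu> \<in> T - {D}" "S \<mu> \<noteq> {}"
    then show "is_basis (r \<mu>) (w \<mu>) (Umin V D \<mu> v)" using w by blast
    have \<mu>T: "\<mu> \<in> T" using \<mu> by blast
    show "\<exists>!C. C \<in> arrays (insert \<mu> (S \<mu>)) r \<and>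
        matricisation_rank \<mu> (insert \<mu> (S \<mu>)) r C = dim (Umin V D \<mu> v) \<and>
        dim (Umin V D \<mu> v) = r \<mu> \<and>
        (\<forall>m\<in>{1..r \<mu>}. w \<mu> m =
          (\<Sum>i\<in>multi_indices (S \<mu>) r. C (i(\<mu> := m)) *\<^sub>R (\<Prod>\<beta>\<in>S \<mu>. w \<beta> (i \<beta>))))"
      using inner_array_exists_unique[OF tree(1,2) \<mu>T \<mu>(2) vD sons[OF \<mu>T] w[OF \<mu>T]]
      by (simp only: dim[OF \<mu>T] simp_thms)
  qed
qed

text \<open>
  Below the root, the bases determine the dimensions. At the root the dimension is \<open>0\<close> or \<open>1\<close>
  according to whether \<open>v\<close> vanishes. Let \<open>z\<close> be a tensor that realises the admissible ranks \<open>r\<close>: at a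
  son of the root \<open>v\<close> and \<open>z\<close> have minimal subspaces of equal dimension, so they vanish together and
  their dimensions agree at the root as well.
\<close>

lemma fixed_rank_of_tree_representation:
  assumes tree: "dim_partition_tree D T S" "finite D" "S D \<noteq> {}"
    and r: "r \<in> admissible_ranks V D T" and v: "v \<in> tensor_space V D"
    and u: "leaf_bases V D T S r v u" and rep: "tree_representation V D T S r v u"
  shows "v \<in> fixed_rank_tensors r V D T"
proof -
  have "D \<in> T" using tree(1) by (simp add: dim_partition_tree_def rooted_tree_def)
  have T: "\<alpha> \<subseteq> D" if "\<alpha> \<in> T" for \<alpha> using tree(1) that by (auto simp: dim_partition_tree_def)
  have below: "dim (Umin V D \<alpha> v) = r \<alpha>" if "\<alpha> \<in> T - {D}" for \<alpha>
  proof (cases "S \<alpha> = {}")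
    case True
    then have "\<alpha> \<in> leaves T S" using that by (simp add: leaves_def)
    then show ?thesis using u is_basis_dim by (auto simp: leaf_bases_def)
  next
    case False
    with rep that show ?thesis
      unfolding tree_representation_def
      by (elim exE conjE) (drule (1) bspec, drule (1) mp, drule conjunct2, erule is_basis_dim)
  qed
  obtain z where z: "z \<in> tensor_space V D" "\<And>\<alpha>. \<alpha> \<in> T \<Longrightarrow> r \<alpha> = dim (Umin V D \<alpha> z)"
    using r by (auto simp: admissible_ranks_def)
  obtain \<beta> where \<beta>: "\<beta> \<in> T - {D}"
    using inner_vertex(6)[OF tree(1,2) \<open>D \<in> T\<close> tree(3)] tree(3) by blast
  have "v = 0 \<longleftrightarrow> z = 0"
    using below[OF \<beta>] z(2)[of \<beta>] \<beta> dim_Umin_eq_0_iff[OF T v, of \<beta>] dim_Umin_eq_0_iff[OF T z(1), of \<beta>]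
    by simp
  then have "dim (Umin V D D v) = r D"
    by (simp add: z(2)[OF \<open>D \<in> T\<close>] dim_Umin_root)
  then show ?thesis
    using below v by (auto simp: fixed_rank_tensors_def)
qed

theorem theorem1:
  fixes V :: "nat \<Rightarrow> 'a::real_vector set" and d \<dd> :: nat and D :: "nat set"
    and T :: "nat set set" and S :: "nat set \<Rightarrow> nat set set"
    and r :: "nat set \<Rightarrow> nat" and v :: "'a tensor"
  assumes "D = {1..d}" and "2 \<le> d"
    and "\<And>j. j \<in> D \<Longrightarrow> subspace (V j)"
    and "dim_partition_tree D T S" and "depth D T S = \<dd>"
    and "r \<in> admissible_ranks V D T"
    and "v \<in> tensor_space V D"
  shows "(v \<in> fixed_rank_tensors r V D T \<longleftrightarrow>
            (\<exists>u. leaf_bases V D T S r v u \<and> tree_representation V D T S r v u)) \<and>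
         (\<forall>u. leaf_bases V D T S r v u \<longrightarrow>
            (v \<in> fixed_rank_tensors r V D T \<longleftrightarrow> tree_representation V D T S r v u))"
proof -
  have D: "finite D" "D \<in> T" "card D = d"
    using assms(1,4) by (auto simp: dim_partition_tree_def rooted_tree_def)
  then have "2 \<le> card (S D)"
    using assms(2,4) by (auto simp: dim_partition_tree_def)
  then have "S D \<noteq> {}" by auto
  note tree = assms(4) D(1) this
  have equiv: "v \<in> fixed_rank_tensors r V D T \<longleftrightarrow> tree_representation V D T S r v u"
    if "leaf_bases V D T S r v u" for u
    using that tree_representation_of_fixed_rank[OF tree]
      fixed_rank_of_tree_representation[OF tree assms(6,7)] by blast
  have "\<exists>u. leaf_bases V D T S r v u" if v: "v \<in> fixed_rank_tensors r V D T"
  proof -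
    have "\<exists>b. is_basis (r k) b (Umin V D k v)" if "k \<in> leaves T S" for k
    proof -
      have k: "k \<in> T" "k \<subseteq> D" using that assms(4) by (auto simp: leaves_def dim_partition_tree_def)
      show ?thesis
        using Umin_basis_exists[OF k(2) assms(7)] v k(1) unfolding fixed_rank_tensors_def by auto
    qed
    then show ?thesis unfolding leaf_bases_def by metis
  qed
  then show ?thesis using equiv by blast
qed

end
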